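(* Let $K\ge 1$ be a fixed integer and $P>0$ a fixed real number. For each integer $N_t\ge K$, let $h_{i,k}$ ($1\le i\le N_t$, $1\le k\le K$) be i.i.d. $\mathcal{CN}(0,1)$ random variables, ${\bf h}_k=(h_{1,k},\dots,h_{N_t,k})^T$, and ${\bf H}=[{\bf h}_1,\dots,{\bf h}_K]^H\in\mathbb{C}^{K\times N_t}$. Let ${\bf F}\in\mathbb{C}^{N_t\times K}$ be given by ${\bf F}_{i,j}=\frac{1}{\sqrt{N_t}}e^{\mathrm{i}\varphi_{i,j}}$ with $\varphi_{i,j}$ the phase of $h_{i,j}$, and let ${\bf f}_k$ be its $k$th column. Let ${\bf H}_{eq}={\bf H}{\bf F}\in\mathbb{C}^{K\times K}$ and ${\bf W}={\bf H}_{eq}^H({\bf H}_{eq}{\bf H}_{eq}^H)^{-1}{\bf \Lambda}$, where ${\bf \Lambda}$ is a positive diagonal matrix chosen so that each column of ${\bf F}{\bf W}$ has unit Euclidean norm (so $\|{\bf F}{\bf W}\|_F^2=K$); let ${\bf w}_j$ be the $j$th column of ${\bf W}$. Define $$\mathrm{SINR}_k=\frac{\frac{P}{K}|{\bf h}_k^H{\bf F}{\bf w}_k|^2}{1+\sum_{j\neq k}\frac{P}{K}|{\bf h}_k^H{\bf F}{\bf w}_j|^2},\qquad R_{\mathrm{PZF}}=\sum_{k=1}^K\mathbb{E}\big[\log_2(1+\mathrm{SINR}_k)\big],$$ and $\mathcal{R}=\mathbb{E}\big[\log_2\big(1+\frac{P}{K}|{\bf h}_k^H{\bf f}_k|^2\big)\big]$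 (which does not depend on $k$). Then $R_{\mathrm{PZF}}\le K\mathcal{R}$, and $$\lim_{N_t\to\infty}\frac{\mathcal{R}}{\log_2\left(1+\frac{\pi}{4}\frac{PN_t}{K}\right)}=1.$$
   Context: This concerns the "phased-ZF" (PZF) hybrid precoding scheme in a downlink multiuser MIMO system with $N_t$ base-station antennas, $K$ RF chains and $K$ single-antenna users, under i.i.d. Rayleigh fading. The received signal of user $k$ is $y_k={\bf h}_k^H{\bf F}{\bf W}{\bf s}+n_k$ with $\mathbb{E}[{\bf s}{\bf s}^H]=\frac{P}{K}{\bf I}_K$ and unit-variance noise $n_k\sim\mathcal{CN}(0,1)$; $\mathrm{SINR}_k$ above is the resulting signal-to-interference-plus-noise ratio and $R_{\mathrm{PZF}}$ the average sum spectral efficiency. Note ${\bf h}_k^H{\bf f}_k=\frac{1}{\sqrt{N_t}}\sum_{i=1}^{N_t}|h_{i,k}|$. $\|\cdot\|_F$ is the Frobenius norm and $(\cdot)^H$ the conjugate transpose. *)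

theory Defs
  imports "HOL-Probability.Probability" "Jordan_Normal_Form.Gauss_Jordan_Elimination"
begin

definition CN01 :: "complex measure" where
  "CN01 = density lborel (\<lambda>z. ennreal (exp (- (cmod z)\<^sup>2) / pi))"

definition chan :: "nat \<Rightarrow> nat \<Rightarrow> ((nat \<times> nat) \<Rightarrow> complex) measure" where
  "chan Nt K = PiM ({..<Nt} \<times> {..<K}) (\<lambda>_. CN01)"

definition cH :: "complex mat \<Rightarrow> complex mat" where
  "cH A = mat (dim_col A) (dim_row A) (\<lambda>(i,j). cnj (A $$ (j,i)))"

definition Hmat :: "nat \<Rightarrow> nat \<Rightarrow> ((nat \<times> nat) \<Rightarrow> complex) \<Rightarrow> complex mat" where
  "Hmat Nt K h = mat K Nt (\<lambda>(k,i). cnj (h (i,k)))"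

definition Fmat :: "nat \<Rightarrow> nat \<Rightarrow> ((nat \<times> nat) \<Rightarrow> complex) \<Rightarrow> complex mat" where
  "Fmat Nt K h = mat Nt K (\<lambda>(i,j). complex_of_real (1 / sqrt (real Nt)) * cis (Arg (h (i,j))))"

definition Heq :: "nat \<Rightarrow> nat \<Rightarrow> ((nat \<times> nat) \<Rightarrow> complex) \<Rightarrow> complex mat" where
  "Heq Nt K h = Hmat Nt K h * Fmat Nt K h"

definition W0 :: "nat \<Rightarrow> nat \<Rightarrow> ((nat \<times> nat) \<Rightarrow> complex) \<Rightarrow> complex mat" where
  "W0 Nt K h = cH (Heq Nt K h) * the (mat_inverse (Heq Nt K h * cH (Heq Nt K h)))"

definition vnorm :: "complex vec \<Rightarrow> real" where
  "vnorm v = sqrt (\<Sum>i<dim_vec v. (cmod (v $ i))\<^sup>2)"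

text \<open>Positive diagonal Lambda making every column of F W have unit Euclidean norm.\<close>
definition Lam :: "nat \<Rightarrow> nat \<Rightarrow> ((nat \<times> nat) \<Rightarrow> complex) \<Rightarrow> complex mat" where
  "Lam Nt K h = mat K K (\<lambda>(i,j). if i = j
      then complex_of_real (1 / vnorm (col (Fmat Nt K h * W0 Nt K h) j)) else 0)"

definition Wmat :: "nat \<Rightarrow> nat \<Rightarrow> ((nat \<times> nat) \<Rightarrow> complex) \<Rightarrow> complex mat" where
  "Wmat Nt K h = W0 Nt K h * Lam Nt K h"

text \<open>h_k^H F w_j = (H F W)_{k,j}.\<close>
definition gain :: "nat \<Rightarrow> nat \<Rightarrow> ((nat \<times> nat) \<Rightarrow> complex) \<Rightarrow> nat \<Rightarrow> nat \<Rightarrow> complex" where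
  "gain Nt K h k j = (Hmat Nt K h * Fmat Nt K h * Wmat Nt K h) $$ (k, j)"

definition SINR :: "real \<Rightarrow> nat \<Rightarrow> nat \<Rightarrow> ((nat \<times> nat) \<Rightarrow> complex) \<Rightarrow> nat \<Rightarrow> real" where
  "SINR P Nt K h k =
     (P / real K * (cmod (gain Nt K h k k))\<^sup>2) /
     (1 + (\<Sum>j\<in>{..<K} - {k}. P / real K * (cmod (gain Nt K h k j))\<^sup>2))"

definition R_PZF :: "real \<Rightarrow> nat \<Rightarrow> nat \<Rightarrow> ennreal" where
  "R_PZF P Nt K = (\<Sum>k<K. \<integral>\<^sup>+ h. ennreal (log 2 (1 + SINR P Nt K h k)) \<partial>chan Nt K)"

text \<open>E[log2(1 + P/K |h_k^H f_k|^2)], with h_k^H f_k = (H F)_{k,k}.\<close>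
definition Rcal :: "real \<Rightarrow> nat \<Rightarrow> nat \<Rightarrow> nat \<Rightarrow> ennreal" where
  "Rcal P Nt K k = (\<integral>\<^sup>+ h. ennreal (log 2 (1 + P / real K *
      (cmod ((Hmat Nt K h * Fmat Nt K h) $$ (k, k)))\<^sup>2)) \<partial>chan Nt K)"

end

theory Submission
  imports
    Defs
    "Jordan_Normal_Form.Determinant"
    "HOL-Number_Theory.Cong"
    "HOL-Real_Asymp.Real_Asymp"
begin

text \<open>
  The effective channel matrix is almost surely invertible, and then zero forcing gives user k the
  gain \<open>|h\<^sub>k\<^sup>H v| / ||v||\<close>, where v is built from cofactors that avoid row k of the effective channel.
  Hence v depends on the column of user k only through its phases, and the gain is at most
  \<open>\<Sum>\<^sub>i r\<^sub>i c\<^sub>i\<close> with \<open>r\<^sub>i\<close> the magnitudes of that column and c a vector of norm at most 1 that is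
  independent of r. No pointwise bound by the equal-weight combination \<open>\<Sum>\<^sub>i r\<^sub>i / \<surd>N\<close> holds, but averaging
  over the cyclic shifts of r, which preserve the distribution, gives the bound in expectation,
  because the logarithm is concave.

  For the limit, \<open>\<Sum>\<^sub>i r\<^sub>i\<close> has mean \<open>N \<surd>\<pi> / 2\<close> and variance of order N. Jensen's inequality bounds the
  rate from above and Chebyshev's inequality bounds it from below up to a constant factor inside the logarithm,
  which the normalisation makes irrelevant.
\<close>

hide_const (open) Determinants.det

section \<open>The complex Gaussian distribution\<close>

lemma nn_integral_lborel_translate:
  fixes f :: "'a::euclidean_space \<Rightarrow> ennreal"
  assumes [measurable]: "f \<in> borel_measurable borel"
  shows "(\<integral>\<^sup>+x. f (c + x) \<partial>lborel) = (\<integral>\<^sup>+x. f x \<partial>lborel)"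
proof -
  have "(\<integral>\<^sup>+x. f x \<partial>lborel) = (\<integral>\<^sup>+x. f x \<partial>distr lborel borel ((+) c))"
    by (simp add: lborel_distr_plus)
  then show ?thesis
    by (simp add: nn_integral_distr)
qed

lemma nn_integral_lborel_reflect:
  fixes f :: "'a::euclidean_space \<Rightarrow> ennreal"
  assumes [measurable]: "f \<in> borel_measurable borel"
  shows "(\<integral>\<^sup>+x. f (c - x) \<partial>lborel) = (\<integral>\<^sup>+x. f x \<partial>lborel)"
proof -
  have "(lborel :: 'a measure) = distr lborel borel (\<lambda>x. c - x)"
    using lborel_affine[of "-1" c] by (simp add: density_1)
  then have "(\<integral>\<^sup>+x. f x \<partial>lborel) = (\<integral>\<^sup>+x. f x \<partial>distr lborel borel (\<lambda>x. c - x))"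
    by simp
  then show ?thesis
    by (simp add: nn_integral_distr)
qed

text \<open>As in the uniqueness proof for Haar measure, both sides are compared through the integral
  of f(e x) B(e x + y) over all pairs (x, y), where B is the indicator of the unit ball.\<close>
lemma nn_integral_lborel_rotate:
  fixes e :: complex and f :: "complex \<Rightarrow> ennreal"
  assumes e: "cmod e = 1" and [measurable]: "f \<in> borel_measurable borel"
  shows "(\<integral>\<^sup>+x. f (e * x) \<partial>lborel) = (\<integral>\<^sup>+x. f x \<partial>lborel)"
proof -
  define B :: "complex \<Rightarrow> ennreal" where "B = indicator (ball 0 1)"
  have [measurable]: "B \<in> borel_measurable borel"
    unfolding B_def by (intro borel_measurable_indicator) simp
  have Be: "B (e * x) = B x" for x
    by (simp add: B_def indicator_def norm_mult e)
  define b where "b = (\<integral>\<^sup>+y. B y \<partial>lborel)"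
  have b: "b = ennreal pi"
    using emeasure_ball[of 1 "0::complex"] by (simp add: b_def B_def unit_ball_vol_2)
  have e0: "e * cnj e = 1"
    using e by (simp add: complex_norm_square[symmetric])
  have e1: "e * (- cnj e * y + x) = e * x - y" for x y
    by (simp add: right_diff_distrib mult.assoc[symmetric] e0)
  have "(\<integral>\<^sup>+x. f (e * x) \<partial>lborel) * b = (\<integral>\<^sup>+x. f (e * x) * (\<integral>\<^sup>+y. B (e * x + y) \<partial>lborel) \<partial>lborel)"
    by (simp add: nn_integral_multc nn_integral_lborel_translate b_def)
  also have "\<dots> = (\<integral>\<^sup>+x. (\<integral>\<^sup>+y. f (e * x) * B (e * x + y) \<partial>lborel) \<partial>lborel)"
    by (simp add: nn_integral_cmult)
  also have "\<dots> = (\<integral>\<^sup>+y. (\<integral>\<^sup>+x. f (e * x) * B (e * x + y) \<partial>lborel) \<partial>lborel)"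
    by (rule lborel_pair.Fubini') simp
  \<comment> \<open>Shifting x by \<open>- cnj e * y\<close> moves \<open>e * x\<close> by
    \<open>- y\<close>, which frees B of y.\<close>
  also have "\<dots> = (\<integral>\<^sup>+y. (\<integral>\<^sup>+x. f (e * x - y) * B (e * x) \<partial>lborel) \<partial>lborel)"
  proof (rule nn_integral_cong)
    fix y
    have "(\<integral>\<^sup>+x. f (e * x) * B (e * x + y) \<partial>lborel)
        = (\<integral>\<^sup>+x. f (e * (- cnj e * y + x)) * B (e * (- cnj e * y + x) + y) \<partial>lborel)"
      by (rule nn_integral_lborel_translate[symmetric]) simp
    also have "\<dots> = (\<integral>\<^sup>+x. f (e * x - y) * B (e * x) \<partial>lborel)"
      by (simp only: e1 diff_add_cancel)
    finally show "(\<integral>\<^sup>+x. f (e * x) * B (e * x + y) \<partial>lborel) = (\<integral>\<^sup>+x. f (e * x - y) * B (e * x) \<partial>lborel)" .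
  qed
  also have "\<dots> = (\<integral>\<^sup>+x. (\<integral>\<^sup>+y. f (e * x - y) * B (e * x) \<partial>lborel) \<partial>lborel)"
    by (rule lborel_pair.Fubini') simp
  \<comment> \<open>The inner integral over y loses its offset \<open>e * x\<close> by reflection,
    and B is radial, so no rotation is left.\<close>
  also have "\<dots> = (\<integral>\<^sup>+x. (\<integral>\<^sup>+y. f y \<partial>lborel) * B x \<partial>lborel)"
    by (simp add: nn_integral_multc nn_integral_lborel_reflect Be)
  also have "\<dots> = (\<integral>\<^sup>+x. f x \<partial>lborel) * b"
    by (simp add: nn_integral_cmult b_def)
  finally have "ennreal pi * (\<integral>\<^sup>+x. f (e * x) \<partial>lborel) = ennreal pi * (\<integral>\<^sup>+x. f x \<partial>lborel)"
    by (simp add: b mult.commute)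
  then show ?thesis
    by (simp add: ennreal_mult_cancel_left)
qed

section \<open>Rotation invariance, radial law and moments of the Gaussian measure\<close>

lemma sets_CN01[simp, measurable_cong]: "sets CN01 = sets borel"
  by (simp add: CN01_def)

lemma space_CN01[simp]: "space CN01 = UNIV"
  by (simp add: CN01_def)

lemma nn_integral_CN01:
  assumes [measurable]: "f \<in> borel_measurable borel"
  shows "(\<integral>\<^sup>+z. f z \<partial>CN01) = (\<integral>\<^sup>+z. ennreal (exp (- (cmod z)\<^sup>2) / pi) * f z \<partial>lborel)"
  unfolding CN01_def by (subst nn_integral_density) auto

lemma distr_CN01_rotate:
  assumes e: "cmod e = 1"
  shows "distr CN01 CN01 (\<lambda>z. e * z) = CN01"
proof (rule measure_eqI)
  fix A assume "A \<in> sets (distr CN01 CN01 (\<lambda>z. e * z))"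
  then have [measurable]: "A \<in> sets borel" by simp
  have "emeasure (distr CN01 CN01 (\<lambda>z. e * z)) A = (\<integral>\<^sup>+z. indicator A (e * z) \<partial>CN01)"
    by (subst nn_integral_indicator[symmetric], simp, subst nn_integral_distr) auto
  also have "\<dots> = (\<integral>\<^sup>+z. ennreal (exp (- (cmod (e * z))\<^sup>2) / pi) * indicator A (e * z) \<partial>lborel)"
    by (subst nn_integral_CN01) (auto simp: norm_mult e)
  also have "\<dots> = (\<integral>\<^sup>+z. ennreal (exp (- (cmod z)\<^sup>2) / pi) * indicator A z \<partial>lborel)"
    by (rule nn_integral_lborel_rotate[OF e]) simp
  also have "\<dots> = emeasure CN01 A"
    by (subst nn_integral_CN01[symmetric]) auto
  finally show "emeasure (distr CN01 CN01 (\<lambda>z. e * z)) A = emeasure CN01 A" .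
qed simp

text \<open>A disc of squared radius u has area pi u, so both measures agree on the half-lines,
  which generate the Borel sets and are closed under intersection.\<close>

lemma distr_lborel_cmod_power2:
  "distr lborel borel (\<lambda>z::complex. (cmod z)\<^sup>2) = density lborel (\<lambda>u. ennreal pi * indicator {0..} u)"
proof (rule measure_eqI_generator_eq[where E="range lessThan :: real set set" and \<Omega>="UNIV :: real set" and A="\<lambda>n. {..<real n}"])
  have sq: "emeasure (distr lborel borel (\<lambda>z::complex. (cmod z)\<^sup>2)) {..<u} = ennreal (pi * max 0 u)" for u
  proof -
    have "(cmod z)\<^sup>2 < u \<longleftrightarrow> cmod z < sqrt (max 0 u)" for z
    proof -
      have "cmod z < sqrt (max 0 u) \<longleftrightarrow> sqrt ((cmod z)\<^sup>2) < sqrt (max 0 u)"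
        by simp
      also have "\<dots> \<longleftrightarrow> (cmod z)\<^sup>2 < max 0 u"
        by (rule real_sqrt_less_iff)
      also have "\<dots> \<longleftrightarrow> (cmod z)\<^sup>2 < u"
        using zero_le_power2[of "cmod z"] by linarith
      finally show ?thesis by simp
    qed
    then have "(\<lambda>z::complex. (cmod z)\<^sup>2) -` {..<u} = ball 0 (sqrt (max 0 u))"
      by auto
    then show ?thesis
      by (simp add: emeasure_distr emeasure_ball unit_ball_vol_2)
  qed
  show "emeasure (distr lborel borel (\<lambda>z::complex. (cmod z)\<^sup>2)) {..<real n} \<noteq> \<infinity>" for n
    by (simp add: sq)
  show "(\<Union>n. {..<real n}) = UNIV"
    using reals_Archimedean2 by auto
  fix X :: "real set" assume "X \<in> range lessThan"
  then obtain u where X: "X = {..<u}" by auto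
  have "emeasure (density lborel (\<lambda>u. ennreal pi * indicator {0..} u)) {..<u}
      = (\<integral>\<^sup>+x. ennreal pi * indicator {0..<u} x \<partial>lborel)"
    by (subst emeasure_density) (auto intro!: nn_integral_cong split: split_indicator)
  also have "\<dots> = ennreal (pi * max 0 u)"
    by (subst nn_integral_cmult_indicator) (auto simp: max_def ennreal_mult')
  finally show "emeasure (distr lborel borel (\<lambda>z::complex. (cmod z)\<^sup>2)) X
      = emeasure (density lborel (\<lambda>u. ennreal pi * indicator {0..} u)) X"
    by (simp add: X sq)
next
  show "Int_stable (range lessThan :: real set set)"
    by (auto simp: Int_stable_def greaterThan_Int_greaterThan)
qed (auto simp: borel_Iio)

text \<open>The Gaussian density is a function of the squared modulus alone, so it passes to the
  image measure, where the area factor pi cancels its 1/pi. The total mass 1 and the moments of the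
  modulus follow from this law.\<close>

lemma distr_CN01_cmod_power2:
  "distr CN01 borel (\<lambda>z. (cmod z)\<^sup>2) = density lborel (\<lambda>u. ennreal (exponential_density 1 u))"
proof -
  have "distr CN01 borel (\<lambda>z. (cmod z)\<^sup>2)
      = density (distr lborel borel (\<lambda>z::complex. (cmod z)\<^sup>2)) (\<lambda>u. ennreal (exp (- u) / pi))"
    unfolding CN01_def by (subst density_distr) auto
  also have "\<dots> = density lborel (\<lambda>u. ennreal pi * indicator {0..} u * ennreal (exp (- u) / pi))"
    unfolding distr_lborel_cmod_power2 by (subst density_density_eq) auto
  also have "\<dots> = density lborel (\<lambda>u. ennreal (exponential_density 1 u))"
    by (intro density_cong)
       (auto simp: exponential_density_def ennreal_mult'[symmetric] split: split_indicator)
  finally show ?thesis .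
qed

lemma prob_space_CN01: "prob_space CN01"
proof -
  have "prob_space (distr CN01 borel (\<lambda>z. (cmod z)\<^sup>2))"
    unfolding distr_CN01_cmod_power2 by (rule prob_space_exponential_density) simp
  then have "emeasure (distr CN01 borel (\<lambda>z. (cmod z)\<^sup>2)) UNIV = 1"
    using prob_space.emeasure_space_1 by force
  then show ?thesis
    by (intro prob_spaceI) (simp add: emeasure_distr)
qed

interpretation CN01: prob_space CN01
  by (rule prob_space_CN01)

lemma nn_integral_CN01_radial:
  assumes [measurable]: "f \<in> borel_measurable borel"
  shows "(\<integral>\<^sup>+z. f ((cmod z)\<^sup>2) \<partial>CN01) = (\<integral>\<^sup>+u. ennreal (exponential_density 1 u) * f u \<partial>lborel)"
proof -
  have "(\<integral>\<^sup>+z. f ((cmod z)\<^sup>2) \<partial>CN01) = (\<integral>\<^sup>+u. f u \<partial>distr CN01 borel (\<lambda>z. (cmod z)\<^sup>2))"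
    by (subst nn_integral_distr) auto
  then show ?thesis
    by (simp add: distr_CN01_cmod_power2 nn_integral_density)
qed

text \<open>In the variable u = |z|^2 the integral is Gamma(3/2). The square of its value is the
  constant pi/4 of the limit.\<close>

lemma nn_integral_CN01_cmod: "(\<integral>\<^sup>+z. ennreal (cmod z) \<partial>CN01) = ennreal (sqrt pi / 2)"
proof -
  have "(\<integral>\<^sup>+z. ennreal (cmod z) \<partial>CN01) = (\<integral>\<^sup>+z. ennreal (sqrt ((cmod z)\<^sup>2)) \<partial>CN01)"
    by simp
  also have "\<dots> = (\<integral>\<^sup>+u. ennreal (exponential_density 1 u) * ennreal (sqrt u) \<partial>lborel)"
    by (rule nn_integral_CN01_radial[where f="\<lambda>u. ennreal (sqrt u)"]) simp
  also have "\<dots> = (\<integral>\<^sup>+u. ennreal (indicator {0..} u * u powr (3/2 - 1) / exp u) \<partial>lborel)"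
    by (intro nn_integral_cong)
       (auto simp: exponential_density_def powr_half_sqrt exp_minus field_simps
          ennreal_mult'[symmetric] split: split_indicator)
  also have "\<dots> = ennreal (Gamma (3/2))"
    using Gamma_conv_nn_integral_real[of "3/2"] by simp
  also have "Gamma (3/2 :: real) = sqrt pi / 2"
    using Gamma_plus1[of "1/2::real"] Gamma_one_half_real nonpos_Ints_nonpos[of "1/2::real"] by force
  finally show ?thesis .
qed

lemma nn_integral_CN01_cmod_power2: "(\<integral>\<^sup>+z. ennreal ((cmod z)\<^sup>2) \<partial>CN01) = 1"
proof -
  have "(\<integral>\<^sup>+z. ennreal ((cmod z)\<^sup>2) \<partial>CN01) = (\<integral>\<^sup>+u. ennreal (exponential_density 1 u) * ennreal u \<partial>lborel)"
    by (rule nn_integral_CN01_radial) simp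
  also have "\<dots> = (\<integral>\<^sup>+u. ennreal (indicator {0..} u * u powr (2 - 1) / exp u) \<partial>lborel)"
    by (intro nn_integral_cong)
       (auto simp: exponential_density_def exp_minus field_simps
          ennreal_mult'[symmetric] split: split_indicator)
  also have "\<dots> = ennreal (Gamma 2)"
    using Gamma_conv_nn_integral_real[of "2"] by simp
  also have "Gamma (2 :: real) = 1"
    using Gamma_fact[of 1, where 'a=real] by simp
  finally show ?thesis by simp
qed

lemma integrable_CN01_cmod: "integrable CN01 cmod"
  using nn_integral_CN01_cmod by (intro integrableI_bounded) auto

lemma integral_CN01_cmod: "(\<integral>z. cmod z \<partial>CN01) = sqrt pi / 2"
  by (rule integral_eq_nn_integral[THEN trans]) (auto simp: nn_integral_CN01_cmod)

lemma integrable_CN01_cmod_power2: "integrable CN01 (\<lambda>z. (cmod z)\<^sup>2)"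
  using nn_integral_CN01_cmod_power2 by (intro integrableI_bounded) auto

lemma integral_CN01_cmod_power2: "(\<integral>z. (cmod z)\<^sup>2 \<partial>CN01) = 1"
  by (rule integral_eq_nn_integral[THEN trans]) (auto simp: nn_integral_CN01_cmod_power2)

section \<open>Null sets of the Gaussian measure\<close>

lemma AE_CN01_negligible:
  assumes "negligible S" and [measurable]: "S \<in> sets borel"
  shows "AE z in CN01. z \<notin> S"
proof -
  have "S \<in> null_sets lborel"
    using assms by (simp add: negligible_iff_null_sets null_sets_completion_iff)
  then have "AE z in lborel. z \<notin> S"
    by (rule AE_not_in)
  then show ?thesis
    unfolding CN01_def by (subst AE_density) auto
qed

lemma AE_CN01_cmod: "AE z in CN01. cmod z \<noteq> c"
  using AE_CN01_negligible[OF negligible_sphere[of 0 c]]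
  by (simp add: borel_closed)

lemma AE_CN01_cis_Arg: "AE z in CN01. cis (Arg z) \<noteq> c"
proof (cases "c = 0")
  case False
  \<comment> \<open>A point with phase c lies on the real line through c, the hyperplane with normal
    \<open>\<i> * c\<close>, which is null.\<close>
  have "AE z in CN01. z \<notin> {z. (\<i> * c) \<bullet> z = 0}"
    using False by (intro AE_CN01_negligible negligible_hyperplane) (auto intro!: borel_closed closed_hyperplane)
  then show ?thesis
  proof eventually_elim
    case (elim z)
    show ?case
    proof
      assume "cis (Arg z) = c"
      then have "z = of_real (cmod z) * c"
        using rcis_cmod_Arg[of z] by (simp add: rcis_def)
      then have "(\<i> * c) \<bullet> z = (\<i> * c) \<bullet> (of_real (cmod z) * c)"
        by simp
      also have "\<dots> = 0"
        by (simp add: inner_complex_def)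
      finally show False
        using elim by simp
    qed
  qed
qed simp

section \<open>Independent complex Gaussian vectors\<close>

lemma product_sigma_finite_CN01: "product_sigma_finite (\<lambda>_. CN01)"
  by (intro product_sigma_finite.intro CN01.sigma_finite_measure_axioms)

abbreviation CNs :: "'i set \<Rightarrow> ('i \<Rightarrow> complex) measure" where
  "CNs I \<equiv> PiM I (\<lambda>_. CN01)"

lemma prob_space_CNs: "prob_space (CNs I)"
  by (intro prob_space_PiM prob_space_CN01)

lemma pair_sigma_finite_CNs: "pair_sigma_finite (CNs I) (CNs J)"
  by (intro pair_sigma_finite.intro prob_space_imp_sigma_finite prob_space_CNs)

text \<open>\<open>Arg\<close> jumps on the negative axis, but the phase factor is
  \<open>sgn\<close> away from 0, and \<open>Arg 0 = 0\<close> makes it 1 at 0.\<close>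

lemma measurable_cis_Arg[measurable]: "(\<lambda>z. cis (Arg z)) \<in> borel_measurable borel"
proof -
  have "(\<lambda>z. cis (Arg z)) = (\<lambda>z. if z = 0 then 1 else sgn z)"
    by (intro ext) (simp add: cis_Arg Arg_zero)
  then show ?thesis
    by simp
qed

lemma cmod_cis_Arg: "of_real (cmod z) * cis (Arg z) = z"
  using rcis_cmod_Arg[of z] by (simp add: rcis_def)

text \<open>At z = 0 the phase factor is 1 by convention, whatever e is, hence the restriction to
  nonzero z; for random z this costs a null set.\<close>

lemma cis_Arg_mult:
  assumes "cmod e = 1" "z \<noteq> 0"
  shows "cis (Arg (e * z)) = e * cis (Arg z)"
proof -
  have "sgn e = e" "e \<noteq> 0"
    using assms by (auto simp: sgn_div_norm)
  then show ?thesis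
    using assms by (simp add: cis_Arg sgn_mult)
qed

lemma AE_CNs_component:
  assumes "i \<in> I" "AE z in CN01. P z"
  shows "AE h in CNs I. P (h i)"
  using assms by (intro AE_PiM_component prob_space_CN01)

lemma AE_CNs_nonzero:
  assumes "finite I"
  shows "AE h in CNs I. \<forall>i\<in>I. h i \<noteq> 0"
  using assms AE_CN01_cmod[of 0] by (auto intro!: AE_finite_allI AE_CNs_component)

lemma distr_CNs_rotate:
  assumes I: "finite I" and e: "\<And>i. i \<in> I \<Longrightarrow> cmod (e i) = 1"
  shows "distr (CNs I) (CNs I) (\<lambda>h. \<lambda>i\<in>I. e i * h i) = CNs I"
proof (rule product_sigma_finite.PiM_eqI[OF product_sigma_finite_CN01 I])
  fix A :: "'a \<Rightarrow> complex set" assume A: "\<And>i. i \<in> I \<Longrightarrow> A i \<in> sets CN01"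
  have vA: "(\<lambda>z. e i * z) -` A i \<in> sets CN01" if "i \<in> I" for i
    using A[OF that] measurable_sets_borel[of "\<lambda>z. e i * z" borel "A i"] by simp
  have "emeasure (distr (CNs I) (CNs I) (\<lambda>h. \<lambda>i\<in>I. e i * h i)) (Pi\<^sub>E I A)
      = emeasure (CNs I) ((\<lambda>h. \<lambda>i\<in>I. e i * h i) -` Pi\<^sub>E I A \<inter> space (CNs I))"
    using I A by (intro emeasure_distr sets_PiM_I_finite) auto
  also have "(\<lambda>h. \<lambda>i\<in>I. e i * h i) -` Pi\<^sub>E I A \<inter> space (CNs I) = Pi\<^sub>E I (\<lambda>i. (\<lambda>z. e i * z) -` A i)"
    by (auto simp: space_PiM PiE_iff)
  also have "emeasure (CNs I) \<dots> = (\<Prod>i\<in>I. emeasure CN01 ((\<lambda>z. e i * z) -` A i))"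
    using I vA by (intro product_sigma_finite.emeasure_PiM[OF product_sigma_finite_CN01])
  also have "\<dots> = (\<Prod>i\<in>I. emeasure (distr CN01 CN01 (\<lambda>z. e i * z)) (A i))"
    using A by (intro prod.cong refl) (subst emeasure_distr, auto)
  also have "\<dots> = (\<Prod>i\<in>I. emeasure CN01 (A i))"
    using e by (intro prod.cong refl) (simp add: distr_CN01_rotate)
  finally show "emeasure (distr (CNs I) (CNs I) (\<lambda>h. \<lambda>i\<in>I. e i * h i)) (Pi\<^sub>E I A)
      = (\<Prod>i\<in>I. emeasure CN01 (A i))" .
qed simp

lemma nn_integral_CNs_rotate:
  assumes "finite I" "\<And>i. i \<in> I \<Longrightarrow> cmod (e i) = 1" and [measurable]: "f \<in> borel_measurable (CNs I)"
  shows "(\<integral>\<^sup>+h. f (\<lambda>i\<in>I. e i * h i) \<partial>CNs I) = (\<integral>\<^sup>+h. f h \<partial>CNs I)"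
proof -
  have "(\<integral>\<^sup>+h. f h \<partial>CNs I) = (\<integral>\<^sup>+h. f h \<partial>distr (CNs I) (CNs I) (\<lambda>h. \<lambda>i\<in>I. e i * h i))"
    using assms by (subst distr_CNs_rotate) auto
  then show ?thesis
    by (simp add: nn_integral_distr)
qed

lemma distr_CNs_reindex:
  assumes "inj_on s I" "s \<in> I \<rightarrow> J"
  shows "distr (CNs J) (CNs I) (\<lambda>h. \<lambda>i\<in>I. h (s i)) = CNs I"
  using assms by (intro distr_PiM_reindex prob_space_CN01)

lemma nn_integral_CNs_reindex:
  assumes s: "inj_on s I" "s \<in> I \<rightarrow> J" and [measurable]: "f \<in> borel_measurable (CNs I)"
  shows "(\<integral>\<^sup>+h. f (\<lambda>i\<in>I. h (s i)) \<partial>CNs J) = (\<integral>\<^sup>+h. f h \<partial>CNs I)"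
proof -
  have [measurable]: "(\<lambda>h. \<lambda>i\<in>I. h (s i)) \<in> measurable (CNs J) (CNs I)"
    using s(2) by (intro measurable_restrict measurable_component_singleton) auto
  have "(\<integral>\<^sup>+h. f h \<partial>CNs I) = (\<integral>\<^sup>+h. f h \<partial>distr (CNs J) (CNs I) (\<lambda>h. \<lambda>i\<in>I. h (s i)))"
    using s by (subst distr_CNs_reindex) auto
  then show ?thesis
    by (simp add: nn_integral_distr)
qed

text \<open>Moduli and phases are independent: the phases may come from an independent copy g. Two
  rotations prove it, one of h by the phases of g and one of g by the phases of h.\<close>

lemma nn_integral_CNs_polar:
  assumes I: "finite I" and [measurable]: "f \<in> borel_measurable (CNs I)"
  shows "(\<integral>\<^sup>+h. f h \<partial>CNs I)
    = (\<integral>\<^sup>+g. (\<integral>\<^sup>+h. f (\<lambda>i\<in>I. of_real (cmod (h i)) * cis (Arg (g i))) \<partial>CNs I) \<partial>CNs I)"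
proof -
  interpret pair_sigma_finite "CNs I" "CNs I"
    by (rule pair_sigma_finite_CNs)
  interpret P: prob_space "CNs I"
    by (rule prob_space_CNs)
  have "(\<integral>\<^sup>+h. f h \<partial>CNs I) = (\<integral>\<^sup>+g. (\<integral>\<^sup>+h. f h \<partial>CNs I) \<partial>CNs I)"
    by (simp add: P.emeasure_space_1)
  also have "\<dots> = (\<integral>\<^sup>+g. (\<integral>\<^sup>+h. f (\<lambda>i\<in>I. cis (Arg (g i)) * h i) \<partial>CNs I) \<partial>CNs I)"
    using I by (intro nn_integral_cong nn_integral_CNs_rotate[symmetric]) auto
  also have "\<dots> = (\<integral>\<^sup>+h. (\<integral>\<^sup>+g. f (\<lambda>i\<in>I. cis (Arg (g i)) * h i) \<partial>CNs I) \<partial>CNs I)"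
    by (rule Fubini') measurable
  also have "\<dots> = (\<integral>\<^sup>+h. (\<integral>\<^sup>+g. f (\<lambda>i\<in>I. of_real (cmod (h i)) * cis (Arg (g i))) \<partial>CNs I) \<partial>CNs I)"
  proof (rule nn_integral_cong)
    fix h :: "'a \<Rightarrow> complex" assume h: "h \<in> space (CNs I)"
    let ?F = "\<lambda>g. f (\<lambda>i\<in>I. of_real (cmod (h i)) * cis (Arg (g i)))"
    \<comment> \<open>The product has the modulus of \<open>h i\<close>, and its phase is that of
      \<open>g i\<close> turned by the phase of \<open>h i\<close>; with h fixed, this turn
      preserves the law of g.\<close>
    have "(\<integral>\<^sup>+g. f (\<lambda>i\<in>I. cis (Arg (g i)) * h i) \<partial>CNs I) = (\<integral>\<^sup>+g. ?F (\<lambda>i\<in>I. cis (Arg (h i)) * g i) \<partial>CNs I)"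
    proof (rule nn_integral_cong_AE)
      show "AE g in CNs I. f (\<lambda>i\<in>I. cis (Arg (g i)) * h i) = ?F (\<lambda>i\<in>I. cis (Arg (h i)) * g i)"
        using AE_CNs_nonzero[OF I]
      proof eventually_elim
        case (elim g)
        have "cis (Arg (g i)) * h i = of_real (cmod (h i)) * cis (Arg (cis (Arg (h i)) * g i))" if "i \<in> I" for i
          using elim that cmod_cis_Arg[of "h i"] by (simp add: cis_Arg_mult mult.assoc[symmetric])
        then have "(\<lambda>i\<in>I. cis (Arg (g i)) * h i)
            = (\<lambda>i\<in>I. of_real (cmod (h i)) * cis (Arg ((\<lambda>i\<in>I. cis (Arg (h i)) * g i) i)))"
          by (intro restrict_ext) simp
        then show ?case by simp
      qed
    qed
    also have "\<dots> = (\<integral>\<^sup>+g. ?F g \<partial>CNs I)"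
      using I by (intro nn_integral_CNs_rotate) auto
    finally show "(\<integral>\<^sup>+g. f (\<lambda>i\<in>I. cis (Arg (g i)) * h i) \<partial>CNs I) = (\<integral>\<^sup>+g. ?F g \<partial>CNs I)" .
  qed
  also have "\<dots> = (\<integral>\<^sup>+g. (\<integral>\<^sup>+h. f (\<lambda>i\<in>I. of_real (cmod (h i)) * cis (Arg (g i))) \<partial>CNs I) \<partial>CNs I)"
    by (rule Fubini') measurable
  finally show ?thesis .
qed

text \<open>Once the phases come from an independent copy, permuting the moduli is a mere reindexing
  of h, which leaves the product measure fixed.\<close>

lemma nn_integral_CNs_permute_cmod:
  assumes I: "finite I" and s: "bij_betw s I I" and [measurable]: "f \<in> borel_measurable (CNs I)"
  shows "(\<integral>\<^sup>+h. f (\<lambda>i\<in>I. of_real (cmod (h (s i))) * cis (Arg (h i))) \<partial>CNs I) = (\<integral>\<^sup>+h. f h \<partial>CNs I)"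
proof -
  have sI: "s i \<in> I" if "i \<in> I" for i
    using s that by (auto simp: bij_betw_def)
  have [measurable]: "(\<lambda>h. \<lambda>i\<in>I. of_real (cmod (h (s i))) * cis (Arg (h i))) \<in> measurable (CNs I) (CNs I)"
  proof (rule measurable_restrict)
    fix i assume i: "i \<in> I"
    have "(\<lambda>h. of_real (cmod (h j)) * cis (Arg (h i))) \<in> measurable (CNs I) CN01" if "j \<in> I" for j
      using i that by measurable
    from this[OF sI[OF i]]
    show "(\<lambda>h. of_real (cmod (h (s i))) * cis (Arg (h i))) \<in> measurable (CNs I) CN01" .
  qed
  let ?T = "\<lambda>h g. \<lambda>i\<in>I. complex_of_real (cmod (h i)) * cis (Arg (g i))"
  have "(\<integral>\<^sup>+h. f (\<lambda>i\<in>I. of_real (cmod (h (s i))) * cis (Arg (h i))) \<partial>CNs I)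
      = (\<integral>\<^sup>+g. (\<integral>\<^sup>+h. f (\<lambda>i\<in>I. of_real (cmod (?T h g (s i))) * cis (Arg (?T h g i))) \<partial>CNs I) \<partial>CNs I)"
    by (rule nn_integral_CNs_polar[OF I]) measurable
  also have "\<dots> = (\<integral>\<^sup>+g. (\<integral>\<^sup>+h. f (?T (\<lambda>i\<in>I. h (s i)) g) \<partial>CNs I) \<partial>CNs I)"
  proof (rule nn_integral_cong, rule nn_integral_cong_AE)
    fix g :: "'a \<Rightarrow> complex"
    show "AE h in CNs I. f (\<lambda>i\<in>I. of_real (cmod (?T h g (s i))) * cis (Arg (?T h g i)))
        = f (?T (\<lambda>i\<in>I. h (s i)) g)"
      using AE_CNs_nonzero[OF I]
    proof eventually_elim
      case (elim h)
      \<comment> \<open>A zero modulus would erase the phase of \<open>g i\<close>, so this rests on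
        \<open>h i\<close> being nonzero.\<close>
      have "cis (Arg (of_real (cmod (h i)) * cis (Arg (g i)))) = cis (Arg (g i))" if "i \<in> I" for i
        using elim that by (simp add: cis_Arg sgn_mult sgn_of_real)
      then show ?case
        by (intro arg_cong[where f=f] restrict_ext) (simp add: sI norm_mult)
    qed
  qed
  also have "\<dots> = (\<integral>\<^sup>+g. (\<integral>\<^sup>+h. f (?T h g) \<partial>CNs I) \<partial>CNs I)"
  proof (rule nn_integral_cong)
    fix g :: "'a \<Rightarrow> complex"
    have [measurable]: "(\<lambda>h. ?T h g) \<in> measurable (CNs I) (CNs I)"
      by (rule measurable_restrict) measurable
    show "(\<integral>\<^sup>+h. f (?T (\<lambda>i\<in>I. h (s i)) g) \<partial>CNs I) = (\<integral>\<^sup>+h. f (?T h g) \<partial>CNs I)"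
      using s by (intro nn_integral_CNs_reindex) (auto simp: bij_betw_def)
  qed
  also have "\<dots> = (\<integral>\<^sup>+h. f h \<partial>CNs I)"
    by (rule nn_integral_CNs_polar[OF I, symmetric]) measurable
  finally show ?thesis .
qed

text \<open>Coordinate i is split off by Fubini; the new value overwrites the old one, whose
  integral then contributes the factor 1.\<close>

lemma nn_integral_CNs_resample:
  assumes I: "finite I" "i \<in> I" and f[measurable]: "f \<in> borel_measurable (CNs I)"
  shows "(\<integral>\<^sup>+h. (\<integral>\<^sup>+z. f (h(i := z)) \<partial>CN01) \<partial>CNs I) = (\<integral>\<^sup>+h. f h \<partial>CNs I)"
proof -
  define J where "J = I - {i}"
  have J: "finite J" "i \<notin> J" "I = insert i J"
    using I by (auto simp: J_def)
  have [measurable]: "(\<lambda>(h, z). h(i := z)) \<in> measurable (CNs I \<Otimes>\<^sub>M CN01) (CNs I)"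
    unfolding split_beta' using I by (intro measurable_fun_upd[where J=I]) auto
  have g[measurable]: "(\<lambda>h. \<integral>\<^sup>+z. f (h(i := z)) \<partial>CN01) \<in> borel_measurable (CNs I)"
    by measurable
  note ins = product_sigma_finite.product_nn_integral_insert[OF product_sigma_finite_CN01 J(1,2)]
  have "(\<integral>\<^sup>+h. (\<integral>\<^sup>+z. f (h(i := z)) \<partial>CN01) \<partial>CNs I) = (\<integral>\<^sup>+x. (\<integral>\<^sup>+y. (\<integral>\<^sup>+z. f (x(i := z)) \<partial>CN01) \<partial>CN01) \<partial>CNs J)"
    using g unfolding J(3) by (subst ins) auto
  also have "\<dots> = (\<integral>\<^sup>+x. (\<integral>\<^sup>+z. f (x(i := z)) \<partial>CN01) \<partial>CNs J)"
    by (simp add: CN01.emeasure_space_1[simplified])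
  also have "\<dots> = (\<integral>\<^sup>+h. f h \<partial>CNs I)"
    using f unfolding J(3) by (subst ins) auto
  finally show ?thesis .
qed

text \<open>Almost sure statements can thus be proved by varying a single coordinate with all others
  frozen; the resampling identity is applied to the indicator of the exceptional set.\<close>

lemma AE_CNs_resample:
  assumes I: "finite I" "i \<in> I" and [measurable]: "Measurable.pred (CNs I) Q"
    and ae: "AE h in CNs I. AE z in CN01. Q (h(i := z))"
  shows "AE h in CNs I. Q h"
proof -
  let ?f = "indicator {h \<in> space (CNs I). \<not> Q h} :: _ \<Rightarrow> ennreal"
  have "(\<integral>\<^sup>+h. ?f h \<partial>CNs I) = (\<integral>\<^sup>+h. (\<integral>\<^sup>+z. ?f (h(i := z)) \<partial>CN01) \<partial>CNs I)"
    using I by (intro nn_integral_CNs_resample[symmetric]) measurable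
  also have "\<dots> = (\<integral>\<^sup>+h. 0 \<partial>CNs I)"
  proof (rule nn_integral_cong_AE)
    show "AE h in CNs I. (\<integral>\<^sup>+z. ?f (h(i := z)) \<partial>CN01) = 0"
      using ae
    proof eventually_elim
      case (elim h)
      have "(\<integral>\<^sup>+z. ?f (h(i := z)) \<partial>CN01) = (\<integral>\<^sup>+z. 0 \<partial>CN01)"
        using elim by (intro nn_integral_cong_AE) (auto simp: indicator_def)
      then show ?case by simp
    qed
  qed
  finally have "emeasure (CNs I) {h \<in> space (CNs I). \<not> Q h} = 0"
    by simp
  then show ?thesis
    by (subst AE_iff_measurable[OF _ refl]) auto
qed

section \<open>Random determinants\<close>

lemma measurable_det[measurable (raw)]:
  assumes "\<And>i j. i < n \<Longrightarrow> j < n \<Longrightarrow> (\<lambda>x. a x i j :: complex) \<in> borel_measurable M"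
  shows "(\<lambda>x. det (mat n n (\<lambda>(i, j). a x i j))) \<in> borel_measurable M"
proof -
  have "det (mat n n (\<lambda>(i, j). a x i j))
      = (\<Sum>p\<in>{p. p permutes {0..<n}}. signof p * (\<Prod>i = 0..<n. a x i (p i)))" for x
    by (subst det_def'[of _ n]) (auto intro!: sum.cong prod.cong dest: permutes_in_image)
  moreover have "(\<lambda>x. a x i (p i)) \<in> borel_measurable M"
    if "p permutes {0..<n}" "i \<in> {0..<n}" for p i
    using assms[of i "p i"] that permutes_in_image[OF that(1), of i] by auto
  ultimately show ?thesis
    by (auto intro!: borel_measurable_sum borel_measurable_times borel_measurable_prod)
qed

text \<open>Row i is deleted before the minor is formed, so the matrices may differ there.\<close>

lemma cofactor_cong:
  assumes "i < n" "\<And>i' j'. i' < n \<Longrightarrow> j' < n \<Longrightarrow> i' \<noteq> i \<Longrightarrow> a i' j' = b i' j'"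
  shows "cofactor (mat n n (\<lambda>(i, j). a i j)) i j = cofactor (mat n n (\<lambda>(i, j). b i j)) i j"
proof -
  have "mat_delete (mat n n (\<lambda>(i, j). a i j)) i j = mat_delete (mat n n (\<lambda>(i, j). b i j)) i j"
    using assms by (intro eq_matI) (auto simp: mat_delete_def)
  then show ?thesis
    by (simp add: cofactor_def)
qed

lemma measurable_cofactor:
  assumes "\<And>i' j'. i' < n \<Longrightarrow> j' < n \<Longrightarrow> (\<lambda>x. a x i' j' :: complex) \<in> borel_measurable M" and "i < n" "j < n"
  shows "(\<lambda>x. cofactor (mat n n (\<lambda>(i, j). a x i j)) i j) \<in> borel_measurable M"
proof -
  have "mat_delete (mat n n (\<lambda>(i, j). a x i j)) i j
      = mat (n - 1) (n - 1) (\<lambda>(i', j'). a x (if i' < i then i' else Suc i') (if j' < j then j' else Suc j'))" for x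
    using assms(2,3) by (auto simp: mat_delete_def)
  then show ?thesis
    using assms unfolding cofactor_def
    by (auto intro!: borel_measurable_times measurable_det)
qed

text \<open>Rows are switched from b to a + \<xi> b one at a time. Expanding along row m, the determinant
  with m + 1 rows switched is \<alpha> + \<xi>(h(m,m)) \<beta>, where \<beta> is the determinant with m rows switched
  and neither \<alpha> nor \<beta> depends on the coordinate (m, m).\<close>
lemma AE_det_nonzero:
  fixes a b :: "((nat \<times> nat) \<Rightarrow> complex) \<Rightarrow> nat \<Rightarrow> nat \<Rightarrow> complex" and \<xi> :: "complex \<Rightarrow> complex"
  assumes I: "finite I" "\<And>k. k < n \<Longrightarrow> (k, k) \<in> I"
    and [measurable]: "\<xi> \<in> borel_measurable borel"
    and atomless: "\<And>c. AE z in CN01. \<xi> z \<noteq> c"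
    and am: "\<And>k j. k < n \<Longrightarrow> j < n \<Longrightarrow> (\<lambda>h. a h k j) \<in> borel_measurable (CNs I)"
    and bm: "\<And>k j. k < n \<Longrightarrow> j < n \<Longrightarrow> (\<lambda>h. b h k j) \<in> borel_measurable (CNs I)"
    and a: "\<And>h k j m z. k < n \<Longrightarrow> j < n \<Longrightarrow> m < n \<Longrightarrow> a (h((m, m) := z)) k j = a h k j"
    and b: "\<And>h k j m z. k < n \<Longrightarrow> j < n \<Longrightarrow> m < n \<Longrightarrow> b (h((m, m) := z)) k j = b h k j"
    and det: "\<And>h. det (mat n n (\<lambda>(k, j). b h k j)) \<noteq> 0"
  shows "AE h in CNs I. det (mat n n (\<lambda>(k, j). a h k j + \<xi> (h (k, k)) * b h k j)) \<noteq> 0"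
proof -
  define D where "D m h = mat n n (\<lambda>(k, j). if k < m then a h k j + \<xi> (h (k, k)) * b h k j else b h k j)" for m h
  have meas: "(\<lambda>h. det (D m h)) \<in> borel_measurable (CNs I)" for m
    unfolding D_def
  proof (rule measurable_det)
    fix k j assume kj: "k < n" "j < n"
    note [measurable] = am[OF kj] bm[OF kj] and I(2)[OF kj(1), simp]
    show "(\<lambda>h. if k < m then a h k j + \<xi> (h (k, k)) * b h k j else b h k j) \<in> borel_measurable (CNs I)"
      by measurable
  qed
  have "AE h in CNs I. det (D m h) \<noteq> 0" if "m \<le> n" for m
    using that
  proof (induction m)
    case 0
    then show ?case
      using det by (simp add: D_def)
  next
    case (Suc m)
    then have m: "m < n" and IH: "AE h in CNs I. det (D m h) \<noteq> 0"
      by auto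
    show ?case
    proof (rule AE_CNs_resample[OF I(1) I(2)[OF m]])
      show "Measurable.pred (CNs I) (\<lambda>h. det (D (Suc m) h) \<noteq> 0)"
        using meas[of "Suc m"] by measurable
      show "AE h in CNs I. AE z in CN01. det (D (Suc m) (h((m, m) := z))) \<noteq> 0"
        using IH
      proof eventually_elim
        case (elim h)
        define \<alpha> where "\<alpha> = (\<Sum>j<n. a h m j * cofactor (D m h) m j)"
        have expand: "det (D (Suc m) (h((m, m) := z))) = \<alpha> + \<xi> z * det (D m h)" for z
        proof -
          have "cofactor (D (Suc m) (h((m, m) := z))) m j = cofactor (D m h) m j" for j
            unfolding D_def using m by (intro cofactor_cong) (auto simp: a b)
          then have "det (D (Suc m) (h((m, m) := z)))
              = (\<Sum>j<n. (a h m j + \<xi> z * b h m j) * cofactor (D m h) m j)"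
            using m by (subst laplace_expansion_row[of _ n m]) (auto simp: D_def a b)
          moreover have "det (D m h) = (\<Sum>j<n. b h m j * cofactor (D m h) m j)"
            using m by (subst laplace_expansion_row[of _ n m]) (auto simp: D_def)
          ultimately show ?thesis
            by (simp add: \<alpha>_def distrib_right sum.distrib sum_distrib_left mult.assoc)
        qed
        show ?case
          \<comment> \<open>The determinant is affine in \<open>\<xi> z\<close> with slope
            \<open>det (D m h)\<close>, nonzero by induction; only its root has to be
            avoided.\<close>
          using atomless[of "- \<alpha> / det (D m h)"]
        proof eventually_elim
          case z: (elim z)
          show ?case
            using z elim by (auto simp: expand field_simps add_eq_0_iff)
        qed
      qed
    qed
  qed
  then have "AE h in CNs I. det (D n h) \<noteq> 0"
    by simp
  moreover have "D n h = mat n n (\<lambda>(k, j). a h k j + \<xi> (h (k, k)) * b h k j)" for h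
    by (intro eq_matI) (auto simp: D_def)
  ultimately show ?thesis
    by simp
qed

section \<open>Invertibility of the effective channel\<close>

lemma measurable_cnj[measurable]: "cnj \<in> borel_measurable borel"
  by (intro borel_measurable_continuous_onI continuous_intros)

text \<open>Entries are functions of the indices without matrix bounds, so that measurability and
  dependence on h can be argued entry by entry.\<close>

definition Fent :: "nat \<Rightarrow> ((nat \<times> nat) \<Rightarrow> complex) \<Rightarrow> nat \<Rightarrow> nat \<Rightarrow> complex" where
  "Fent N h i j = of_real (1 / sqrt (real N)) * cis (Arg (h (i, j)))"

definition Hent :: "nat \<Rightarrow> ((nat \<times> nat) \<Rightarrow> complex) \<Rightarrow> nat \<Rightarrow> nat \<Rightarrow> complex" where
  "Hent N h k j = (\<Sum>i<N. cnj (h (i, k)) * Fent N h i j)"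

lemma Fmat_eq: "Fmat N K h = mat N K (\<lambda>(i, j). Fent N h i j)"
  by (simp add: Fmat_def Fent_def)

lemma Heq_eq: "Heq N K h = mat K K (\<lambda>(k, j). Hent N h k j)"
  by (intro eq_matI)
     (auto simp: Heq_def Hmat_def Fmat_eq Hent_def scalar_prod_def lessThan_atLeast0)

lemma measurable_Fent:
  assumes "(i, j) \<in> I"
  shows "(\<lambda>h. Fent N h i j) \<in> borel_measurable (CNs I)"
  using assms unfolding Fent_def by measurable

lemma measurable_Hent:
  assumes "\<And>i. i < N \<Longrightarrow> (i, k) \<in> I" "\<And>i. i < N \<Longrightarrow> (i, j) \<in> I"
  shows "(\<lambda>h. Hent N h k j) \<in> borel_measurable (CNs I)"
  unfolding Hent_def
proof (rule borel_measurable_sum)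
  fix i assume "i \<in> {..<N}"
  then have i: "(i, k) \<in> I" "(i, j) \<in> I"
    using assms by auto
  have "(\<lambda>h. h (i, k)) \<in> borel_measurable (CNs I)"
    using i(1) by measurable
  then show "(\<lambda>h. cnj (h (i, k)) * Fent N h i j) \<in> borel_measurable (CNs I)"
    by (intro borel_measurable_times measurable_Fent[OF i(2)] measurable_compose[OF _ measurable_cnj])
qed

text \<open>Every Leibniz term takes exactly one entry from each row and so carries each factor
  once.\<close>

lemma det_scale_rows:
  fixes c :: "nat \<Rightarrow> 'a::comm_ring_1"
  shows "det (mat n n (\<lambda>(k, j). c k * a k j)) = (\<Prod>k<n. c k) * det (mat n n (\<lambda>(k, j). a k j))"
proof -
  have perm: "p k < n" if "p permutes {0..<n}" "k < n" for p k
    using permutes_in_image[OF that(1), of k] that(2) by simp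
  have "det (mat n n (\<lambda>(k, j). c k * a k j))
      = (\<Sum>p\<in>{p. p permutes {0..<n}}. signof p * (\<Prod>k = 0..<n. c k * a k (p k)))"
    by (subst det_def'[of _ n]) (auto intro!: sum.cong prod.cong simp: perm)
  also have "\<dots> = (\<Prod>k<n. c k) * (\<Sum>p\<in>{p. p permutes {0..<n}}. signof p * (\<Prod>k = 0..<n. a k (p k)))"
    by (simp add: prod.distrib sum_distrib_left mult_ac lessThan_atLeast0)
  also have "(\<Sum>p\<in>{p. p permutes {0..<n}}. signof p * (\<Prod>k = 0..<n. a k (p k)))
      = det (mat n n (\<lambda>(k, j). a k j))"
    by (subst det_def'[of _ n]) (auto intro!: sum.cong prod.cong simp: perm)
  finally show ?thesis .
qed

text \<open>The case of \<open>AE_det_nonzero\<close> in which rows of the identity matrix are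
  replaced one by one by rows of phases. Only the diagonal phase of each row is varied, and
  \<open>K \<le> N\<close> provides the diagonal coordinates.\<close>

lemma AE_det_phases:
  assumes "K \<le> N"
  shows "AE g in CNs ({..<N} \<times> {..<K}). det (mat K K (\<lambda>(k, j). cis (Arg (g (k, j))))) \<noteq> 0"
proof -
  define I where "I = {..<N} \<times> {..<K}"
  have I: "(k, j) \<in> I" if "k < K" "j < K" for k j
    using assms that by (auto simp: I_def)
  define a where "a h k j = (if k = j then 0 else cis (Arg (h (k, j))))" for h :: "nat \<times> nat \<Rightarrow> complex" and k j
  define b where "b h k j = (if k = j then 1 else 0 :: complex)" for h :: "nat \<times> nat \<Rightarrow> complex" and k j :: nat
  have "mat K K (\<lambda>(k, j). b h k j) = 1\<^sub>m K" for h
    by (intro eq_matI) (auto simp: b_def)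
  then have detb: "det (mat K K (\<lambda>(k, j). b h k j)) \<noteq> 0" for h
    by simp
  have am: "(\<lambda>h. a h k j) \<in> borel_measurable (CNs I)" if "k < K" "j < K" for k j
  proof -
    have [measurable]: "(\<lambda>h. h (k, j)) \<in> borel_measurable (CNs I)"
      using I[OF that] by measurable
    show ?thesis
      unfolding a_def by measurable
  qed
  have "AE g in CNs I. det (mat K K (\<lambda>(k, j). a g k j + cis (Arg (g (k, k))) * b g k j)) \<noteq> 0"
    by (rule AE_det_nonzero[OF _ _ _ AE_CN01_cis_Arg am _ _ _ detb])
       (use assms in \<open>auto simp: a_def b_def I_def\<close>)
  moreover have "mat K K (\<lambda>(k, j). a g k j + cis (Arg (g (k, k))) * b g k j)
      = mat K K (\<lambda>(k, j). cis (Arg (g (k, j))))" for g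
    by (intro eq_matI) (auto simp: a_def b_def)
  ultimately show ?thesis
    unfolding I_def by simp
qed

text \<open>The coordinate \<open>h (k, k)\<close> enters row k of \<open>Heq\<close> through its
  conjugate and column k through its phase in F. \<open>nn_integral_CNs_polar\<close> separates the
  two: the phases are frozen at g with an invertible top block, and then only the moduli vary, each
  in a single row.\<close>

lemma AE_det_Heq:
  assumes "K \<le> N"
  shows "AE h in chan N K. det (Heq N K h) \<noteq> 0"
proof -
  define I where "I = {..<N} \<times> {..<K}"
  have fin: "finite I"
    by (simp add: I_def)
  have [measurable]: "(\<lambda>h. det (Heq N K h)) \<in> borel_measurable (CNs I)"
    unfolding Heq_eq by (intro measurable_det measurable_Hent) (auto simp: I_def)
  let ?T = "\<lambda>h g. \<lambda>i\<in>I. complex_of_real (cmod (h i)) * cis (Arg (g i))"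
  let ?f = "indicator {h \<in> space (CNs I). det (Heq N K h) = 0} :: _ \<Rightarrow> ennreal"
  have "(\<integral>\<^sup>+h. ?f h \<partial>CNs I) = (\<integral>\<^sup>+g. (\<integral>\<^sup>+h. ?f (?T h g) \<partial>CNs I) \<partial>CNs I)"
    by (rule nn_integral_CNs_polar[OF fin]) measurable
  also have "\<dots> = (\<integral>\<^sup>+g. 0 \<partial>CNs I)"
  proof (rule nn_integral_cong_AE)
    show "AE g in CNs I. (\<integral>\<^sup>+h. ?f (?T h g) \<partial>CNs I) = 0"
      using AE_det_phases[OF assms] unfolding I_def[symmetric]
    proof eventually_elim
      case (elim g)
      \<comment> \<open>In row k, b is the contribution of antenna k per unit of modulus and a that
        of all other antennas; a never reads a diagonal coordinate.\<close>
      define a where "a h k j = (\<Sum>i\<in>{..<N} - {k}. of_real (cmod (h (i, k))) * (cnj (cis (Arg (g (i, k)))) * Fent N g i j))"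
        for h :: "nat \<times> nat \<Rightarrow> complex" and k j
      define b where "b h k j = cnj (cis (Arg (g (k, k)))) * Fent N g k j"
        for h :: "nat \<times> nat \<Rightarrow> complex" and k j
      have "det (mat K K (\<lambda>(k, j). b h k j)) \<noteq> 0" for h
      proof -
        \<comment> \<open>So b is the phase matrix of the first K antennas with nonzero row
          factors.\<close>
        have "(\<lambda>(k, j). b h k j) = (\<lambda>(k, j). (cnj (cis (Arg (g (k, k)))) * of_real (1 / sqrt (real N))) * cis (Arg (g (k, j))))"
          by (auto simp: b_def Fent_def)
        then show ?thesis
          using elim assms by (simp only: det_scale_rows) auto
      qed
      moreover have "(\<lambda>h. a h k j) \<in> borel_measurable (CNs I)" if "k < K" for k j
        unfolding a_def
      proof (rule borel_measurable_sum)
        fix i assume "i \<in> {..<N} - {k}"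
        then have "(i, k) \<in> I"
          using that by (auto simp: I_def)
        then have [measurable]: "(\<lambda>h. h (i, k)) \<in> borel_measurable (CNs I)"
          by measurable
        show "(\<lambda>h. of_real (cmod (h (i, k))) * (cnj (cis (Arg (g (i, k)))) * Fent N g i j)) \<in> borel_measurable (CNs I)"
          by measurable
      qed
      ultimately have "AE h in CNs I. det (mat K K (\<lambda>(k, j). a h k j + of_real (cmod (h (k, k))) * b h k j)) \<noteq> 0"
      proof (intro AE_det_nonzero)
        show "AE z in CN01. of_real (cmod z) \<noteq> c" for c :: complex
          using AE_CN01_cmod[of "Re c"] by eventually_elim auto
      qed (use assms in \<open>auto simp: fin I_def a_def b_def intro!: sum.cong split: if_splits\<close>)
      then have "AE h in CNs I. ?f (?T h g) = 0"
        using AE_CNs_nonzero[OF fin]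
      proof eventually_elim
        case h: (elim h)
        have "Hent N (?T h g) k j = a h k j + of_real (cmod (h (k, k))) * b h k j" if "k < K" "j < K" for k j
        proof -
          have F: "Fent N (?T h g) i j = Fent N g i j" if "i < N" for i
            using h that \<open>j < K\<close> by (simp add: Fent_def I_def cis_Arg sgn_mult sgn_of_real)
          have "Hent N (?T h g) k j = (\<Sum>i<N. of_real (cmod (h (i, k))) * (cnj (cis (Arg (g (i, k)))) * Fent N g i j))"
            unfolding Hent_def
          proof (rule sum.cong)
            fix i assume "i \<in> {..<N}"
            then have "?T h g (i, k) = of_real (cmod (h (i, k))) * cis (Arg (g (i, k)))"
              "Fent N (?T h g) i j = Fent N g i j"
              using \<open>k < K\<close> by (simp_all only: F lessThan_iff) (simp add: I_def)
            then show "cnj (?T h g (i, k)) * Fent N (?T h g) i j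
                = of_real (cmod (h (i, k))) * (cnj (cis (Arg (g (i, k)))) * Fent N g i j)"
              by (simp only: complex_cnj_mult complex_cnj_complex_of_real mult.assoc)
          qed simp
          also have "\<dots> = a h k j + of_real (cmod (h (k, k))) * b h k j"
            unfolding a_def b_def using that assms by (subst sum.remove[of _ k]) auto
          finally show ?thesis .
        qed
        then have "Heq N K (?T h g) = mat K K (\<lambda>(k, j). a h k j + of_real (cmod (h (k, k))) * b h k j)"
          unfolding Heq_eq by (intro eq_matI) auto
        then show ?case
          using h(1) by simp
      qed
      then have "(\<integral>\<^sup>+h. ?f (?T h g) \<partial>CNs I) = (\<integral>\<^sup>+h. 0 \<partial>CNs I)"
        by (rule nn_integral_cong_AE)
      then show ?case by simp
    qed
  qed
  finally have "emeasure (CNs I) {h \<in> space (CNs I). det (Heq N K h) = 0} = 0"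
    by simp
  then have "AE h in CNs I. det (Heq N K h) \<noteq> 0"
    by (subst AE_iff_measurable[OF _ refl]) auto
  then show ?thesis
    unfolding chan_def I_def .
qed

section \<open>The zero-forcing gain\<close>

text \<open>Up to the factor det Heq, column k of F W; it depends on column k of the channel only
  through the phases.\<close>
definition zf_vec :: "nat \<Rightarrow> nat \<Rightarrow> ((nat \<times> nat) \<Rightarrow> complex) \<Rightarrow> nat \<Rightarrow> nat \<Rightarrow> complex" where
  "zf_vec N K h k i = (\<Sum>j<K. Fent N h i j * cofactor (Heq N K h) k j)"

definition zf_norm :: "nat \<Rightarrow> nat \<Rightarrow> ((nat \<times> nat) \<Rightarrow> complex) \<Rightarrow> nat \<Rightarrow> real" where
  "zf_norm N K h k = sqrt (\<Sum>i<N. (cmod (zf_vec N K h k i))\<^sup>2)"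

lemma Heq_carrier: "Heq N K h \<in> carrier_mat K K"
  by (simp add: Heq_eq)

lemma det_cH:
  assumes A: "A \<in> carrier_mat n n"
  shows "det (cH A) = cnj (det A)"
proof -
  interpret cnj: comm_ring_hom cnj
    by unfold_locales auto
  have "cH A = map_mat cnj (transpose_mat A)"
    using A by (intro eq_matI) (auto simp: cH_def)
  then show ?thesis
    using A by (simp add: det_transpose)
qed

text \<open>The Gram matrix has determinant |det Heq|^2, so \<open>mat_inverse\<close> succeeds and
  \<open>the\<close> returns a genuine inverse.\<close>

lemma Heq_W0:
  assumes d: "det (Heq N K h) \<noteq> 0"
  shows "W0 N K h \<in> carrier_mat K K" "Heq N K h * W0 N K h = 1\<^sub>m K"
proof -
  let ?A = "Heq N K h"
  let ?G = "?A * cH ?A"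
  have A: "?A \<in> carrier_mat K K"
    by (rule Heq_carrier)
  then have cA: "cH ?A \<in> carrier_mat K K"
    by (simp add: cH_def)
  have G: "?G \<in> carrier_mat K K"
    using A cA by simp
  have "det ?G \<noteq> 0"
    using d by (simp add: det_mult[OF A cA] det_cH[OF A])
  then have "?G \<in> Units (ring_mat TYPE(complex) K ())"
    by (rule det_non_zero_imp_unit[OF G])
  then obtain B where B: "mat_inverse ?G = Some B"
    using mat_inverse(1)[OF G, where b="()"] by (cases "mat_inverse ?G") auto
  have GB: "?G * B = 1\<^sub>m K" "B \<in> carrier_mat K K"
    using mat_inverse(2)[OF G B] by auto
  have W: "W0 N K h = cH ?A * B"
    by (simp add: W0_def B)
  show "W0 N K h \<in> carrier_mat K K"
    using cA GB by (simp add: W)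
  show "?A * W0 N K h = 1\<^sub>m K"
    using GB A cA by (simp add: W flip: assoc_mult_mat)
qed

text \<open>Cramer's rule: multiplying \<open>Heq * W0 = 1\<close> by the adjugate identifies
  \<open>W0\<close> up to the determinant. The indices are swapped as in the adjugate.\<close>

lemma W0_entry:
  assumes d: "det (Heq N K h) \<noteq> 0" and jk: "j < K" "k < K"
  shows "det (Heq N K h) * W0 N K h $$ (j, k) = cofactor (Heq N K h) k j"
proof -
  let ?A = "Heq N K h"
  have A: "?A \<in> carrier_mat K K"
    by (rule Heq_carrier)
  note W = Heq_W0[OF d]
  note adj = adj_mat[OF A]
  have "det ?A \<cdot>\<^sub>m W0 N K h = (adj_mat ?A * ?A) * W0 N K h"
    using W by (simp add: adj mult_smult_assoc_mat[OF one_carrier_mat])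
  also have "\<dots> = adj_mat ?A * (?A * W0 N K h)"
    using A W adj by (intro assoc_mult_mat)
  also have "\<dots> = adj_mat ?A"
    using W adj by simp
  finally have "det ?A \<cdot>\<^sub>m W0 N K h = adj_mat ?A" .
  then have "(det ?A \<cdot>\<^sub>m W0 N K h) $$ (j, k) = adj_mat ?A $$ (j, k)"
    by simp
  then show ?thesis
    using A W jk by (simp add: adj_mat_def)
qed

lemma vnorm_FW0:
  assumes d: "det (Heq N K h) \<noteq> 0" and k: "k < K"
  shows "vnorm (col (Fmat N K h * W0 N K h) k) = zf_norm N K h k / cmod (det (Heq N K h))"
proof -
  let ?D = "det (Heq N K h)"
  note W = Heq_W0(1)[OF d]
  have "(Fmat N K h * W0 N K h) $$ (i, k) = zf_vec N K h k i / ?D" if "i < N" for i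
  proof -
    have "(Fmat N K h * W0 N K h) $$ (i, k) = (\<Sum>j<K. Fent N h i j * W0 N K h $$ (j, k))"
      using W k that by (auto simp: Fmat_eq scalar_prod_def lessThan_atLeast0)
    also have "?D * \<dots> = zf_vec N K h k i"
      unfolding zf_vec_def sum_distrib_left
      by (intro sum.cong refl) (use W0_entry[OF d _ k] in \<open>simp add: mult.left_commute\<close>)
    finally show ?thesis
      using d by (simp add: field_simps)
  qed
  then have "vnorm (col (Fmat N K h * W0 N K h) k) = sqrt (\<Sum>i<N. (cmod (zf_vec N K h k i) / cmod ?D)\<^sup>2)"
    using W k by (simp add: vnorm_def Fmat_eq norm_divide)
  also have "\<dots> = zf_norm N K h k / cmod ?D"
    by (simp add: zf_norm_def power_divide real_sqrt_divide flip: sum_divide_distrib)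
  finally show ?thesis .
qed

text \<open>Zero forcing turns \<open>Heq * Wmat\<close> into \<open>Lam\<close>, so the gain of
  user k is just the normalising factor of column k.\<close>

lemma cmod_gain_diag:
  assumes d: "det (Heq N K h) \<noteq> 0" and k: "k < K"
  shows "cmod (gain N K h k k) = cmod (det (Heq N K h)) / zf_norm N K h k"
proof -
  note W = Heq_W0[OF d]
  have L: "Lam N K h \<in> carrier_mat K K"
    by (simp add: Lam_def)
  have "Heq N K h * Wmat N K h = (Heq N K h * W0 N K h) * Lam N K h"
    unfolding Wmat_def by (rule assoc_mult_mat[symmetric, OF Heq_carrier W(1) L])
  also have "\<dots> = Lam N K h"
    using L by (simp add: W(2))
  finally have "gain N K h k k = Lam N K h $$ (k, k)"
    by (simp add: gain_def flip: Heq_def)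
  moreover have "zf_norm N K h k \<ge> 0"
    by (simp add: zf_norm_def sum_nonneg)
  ultimately show ?thesis
    using k by (simp add: Lam_def vnorm_FW0[OF d] norm_divide)
qed

text \<open>Expansion along row k exhibits the determinant as the inner product of the channel of
  user k with \<open>zf_vec\<close>; by \<open>cmod_gain_diag\<close> the gain is its modulus over
  the norm of that vector.\<close>

lemma det_Heq_zf_vec:
  assumes k: "k < K"
  shows "det (Heq N K h) = (\<Sum>i<N. cnj (h (i, k)) * zf_vec N K h k i)"
proof -
  have "det (Heq N K h) = (\<Sum>j<K. Hent N h k j * cofactor (Heq N K h) k j)"
    using k by (subst laplace_expansion_row[OF Heq_carrier k]) (simp add: Heq_eq)
  also have "\<dots> = (\<Sum>i<N. cnj (h (i, k)) * zf_vec N K h k i)"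
    unfolding Hent_def zf_vec_def sum_distrib_left sum_distrib_right
    by (subst sum.swap) (simp add: mult.assoc)
  finally show ?thesis .
qed

text \<open>The weights in the bound on the gain: moduli of the normalised \<open>zf_vec\<close>,
  since the triangle inequality gives up the phases.\<close>

definition zf_coef :: "nat \<Rightarrow> nat \<Rightarrow> ((nat \<times> nat) \<Rightarrow> complex) \<Rightarrow> nat \<Rightarrow> nat \<Rightarrow> real" where
  "zf_coef N K h k i = cmod (zf_vec N K h k i) / zf_norm N K h k"

text \<open>Not an equality, because zf_coef is 0 (division by 0) when zf_norm is 0.\<close>
lemma sum_zf_coef_power2: "(\<Sum>i<N. (zf_coef N K h k i)\<^sup>2) \<le> 1"
proof -
  have "(\<Sum>i<N. (zf_coef N K h k i)\<^sup>2) = (\<Sum>i<N. (cmod (zf_vec N K h k i))\<^sup>2) / (zf_norm N K h k)\<^sup>2"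
    by (simp add: zf_coef_def power_divide sum_divide_distrib)
  also have "(zf_norm N K h k)\<^sup>2 = (\<Sum>i<N. (cmod (zf_vec N K h k i))\<^sup>2)"
    by (simp add: zf_norm_def sum_nonneg)
  finally show ?thesis
    by simp
qed

text \<open>Triangle inequality in \<open>det_Heq_zf_vec\<close>, as if all antennas added up in
  phase.\<close>

lemma cmod_gain_le:
  assumes d: "det (Heq N K h) \<noteq> 0" and k: "k < K"
  shows "cmod (gain N K h k k) \<le> (\<Sum>i<N. cmod (h (i, k)) * zf_coef N K h k i)"
proof -
  have "cmod (det (Heq N K h)) \<le> (\<Sum>i<N. cmod (h (i, k)) * cmod (zf_vec N K h k i))"
    unfolding det_Heq_zf_vec[OF k] by (rule order_trans[OF norm_sum]) (simp add: norm_mult)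
  then show ?thesis
    using d k by (simp add: cmod_gain_diag zf_coef_def divide_right_mono zf_norm_def sum_nonneg flip: sum_divide_distrib)
qed

lemma SINR_le:
  assumes d: "det (Heq N K h) \<noteq> 0" and k: "k < K" and P: "P > 0"
  shows "SINR P N K h k \<le> P / real K * (\<Sum>i<N. cmod (h (i, k)) * zf_coef N K h k i)\<^sup>2"
proof -
  have "(\<Sum>j\<in>{..<K} - {k}. P / real K * (cmod (gain N K h k j))\<^sup>2) \<ge> 0"
    using P by (intro sum_nonneg) simp
  \<comment> \<open>Interference only enlarges the denominator beyond 1.\<close>
  then have "SINR P N K h k \<le> P / real K * (cmod (gain N K h k k))\<^sup>2"
    using P unfolding SINR_def by (subst divide_le_eq) (auto intro!: mult_right_le_one_le mult_left_mono simp: algebra_simps)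
  also have "\<dots> \<le> P / real K * (\<Sum>i<N. cmod (h (i, k)) * zf_coef N K h k i)\<^sup>2"
    using P cmod_gain_le[OF d k] by (intro mult_left_mono power_mono) auto
  finally show ?thesis .
qed

lemma SINR_nonneg:
  assumes "P > 0"
  shows "SINR P N K h k \<ge> 0"
  using assms unfolding SINR_def by (intro divide_nonneg_nonneg add_nonneg_nonneg sum_nonneg mult_nonneg_nonneg) auto

section \<open>Averaging over cyclic shifts\<close>

lemma bij_betw_add_mod:
  fixes m N :: nat
  assumes "N > 0"
  shows "bij_betw (\<lambda>i. (i + m) mod N) {..<N} {..<N}"
proof -
  have "inj_on (\<lambda>i. (i + m) mod N) {..<N}"
    by (auto simp: inj_on_def simp flip: cong_def simp: cong_add_rcancel_nat) (simp add: cong_def)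
  moreover have "(\<lambda>i. (i + m) mod N) ` {..<N} \<subseteq> {..<N}"
    using assms by auto
  ultimately show ?thesis
    by (simp add: bij_betw_def endo_inj_surj)
qed

lemma sum_shift_mod:
  fixes r :: "nat \<Rightarrow> 'a::comm_monoid_add"
  assumes "N > 0"
  shows "(\<Sum>i<N. r ((i + m) mod N)) = (\<Sum>i<N. r i)"
  using sum.reindex_bij_betw[OF bij_betw_add_mod[OF assms, of m], of r] .

text \<open>Concavity, from \<open>ln u \<le> u - 1\<close> at the ratio u = (1 + x) / (1 + y). It
  stands in for Jensen's inequality both in the average over shifts and in the expectation.\<close>

lemma ln_1p_le_tangent:
  assumes "x \<ge> 0" "y \<ge> (0::real)"
  shows "ln (1 + x) \<le> ln (1 + y) + (x - y) / (1 + y)"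
proof -
  have "ln ((1 + x) / (1 + y)) \<le> (1 + x) / (1 + y) - 1"
    using assms by (intro ln_le_minus_one) simp
  then show ?thesis
    using assms by (simp add: ln_div field_simps)
qed

text \<open>The logarithm is handled by its tangent at the claimed maximum, which leaves
  the second moment; that one is bounded by Cauchy-Schwarz with weights r.\<close>
lemma sum_shifts_ln_le:
  fixes r c :: "nat \<Rightarrow> real"
  assumes N: "N > 0" and s: "s \<ge> 0" and r: "\<And>i. r i \<ge> 0" and c: "(\<Sum>i<N. (c i)\<^sup>2) \<le> 1"
  shows "(\<Sum>m<N. ln (1 + s * (\<Sum>i<N. r ((i + m) mod N) * c i)\<^sup>2))
    \<le> real N * ln (1 + s * (\<Sum>i<N. r i)\<^sup>2 / real N)"
proof -
  define S where "S = (\<Sum>i<N. r i)"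
  have S: "S \<ge> 0"
    unfolding S_def by (intro sum_nonneg r)
  define x where "x m = (\<Sum>i<N. r ((i + m) mod N) * c i)\<^sup>2" for m
  define y where "y = s * S\<^sup>2 / real N"
  have y: "y \<ge> 0"
    using s by (simp add: y_def)
  have "x m \<le> S * (\<Sum>i<N. r ((i + m) mod N) * (c i)\<^sup>2)" for m
  proof -
    define q where "q i = r ((i + m) mod N)" for i
    \<comment> \<open>The product is split so that the squares of the first factor sum to S for
      every shift.\<close>
    have "x m = (\<Sum>i<N. sqrt (q i) * (sqrt (q i) * c i))\<^sup>2"
      unfolding x_def q_def[symmetric] by (simp add: q_def r flip: mult.assoc)
    also have "\<dots> \<le> (\<Sum>i<N. (sqrt (q i))\<^sup>2) * (\<Sum>i<N. (sqrt (q i) * c i)\<^sup>2)"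
      by (rule Cauchy_Schwarz_ineq_sum)
    also have "\<dots> = (\<Sum>i<N. q i) * (\<Sum>i<N. q i * (c i)\<^sup>2)"
      by (simp add: power_mult_distrib q_def r)
    also have "(\<Sum>i<N. q i) = S"
      unfolding q_def S_def by (rule sum_shift_mod[OF N])
    finally show ?thesis
      by (simp add: q_def)
  qed
  then have "(\<Sum>m<N. x m) \<le> (\<Sum>m<N. S * (\<Sum>i<N. r ((i + m) mod N) * (c i)\<^sup>2))"
    by (intro sum_mono)
  \<comment> \<open>As m runs over all shifts, each \<open>c i\<close> meets every value of r
    exactly once, which leaves S times the squared norm of c.\<close>
  also have "\<dots> = S * (\<Sum>i<N. (\<Sum>m<N. r ((m + i) mod N)) * (c i)\<^sup>2)"
    unfolding sum_distrib_left[symmetric] sum_distrib_right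
    by (subst sum.swap) (simp add: add.commute)
  also have "\<dots> = S\<^sup>2 * (\<Sum>i<N. (c i)\<^sup>2)"
    by (simp add: sum_shift_mod[OF N] power2_eq_square sum_distrib_left mult.assoc flip: S_def)
  also have "\<dots> \<le> S\<^sup>2"
    using c by (intro mult_right_le_one_le) (auto intro: sum_nonneg)
  finally have sx: "s * (\<Sum>m<N. x m) \<le> real N * y"
    using s N by (simp add: y_def mult_left_mono)
  have "(\<Sum>m<N. ln (1 + s * x m)) \<le> (\<Sum>m<N. ln (1 + y) + (s * x m - y) / (1 + y))"
    using s y by (intro sum_mono ln_1p_le_tangent) (auto simp: x_def)
  also have "\<dots> = real N * ln (1 + y) + (s * (\<Sum>m<N. x m) - real N * y) / (1 + y)"
    by (simp add: sum.distrib sum_distrib_left sum_subtractf flip: sum_divide_distrib)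
  also have "\<dots> \<le> real N * ln (1 + y)"
    using sx y by (simp add: divide_nonpos_pos)
  finally show ?thesis
    by (simp add: x_def y_def S_def)
qed

section \<open>The sum rate bound\<close>

lemma cis_Arg_cis: "cis (Arg (cis t)) = cis t"
  by (simp add: cis_Arg)

text \<open>Column k of F carries the phases of user k itself, so all antennas add in phase.\<close>

lemma Hent_diag: "Hent N h k k = of_real ((\<Sum>i<N. cmod (h (i, k))) / sqrt (real N))"
proof -
  have "cnj z * cis (Arg z) = of_real (cmod z)" for z
  proof -
    have "cnj z * cis (Arg z) = cnj (of_real (cmod z) * cis (Arg z)) * cis (Arg z)"
      by (simp only: cmod_cis_Arg)
    also have "\<dots> = of_real (cmod z)"
      by (simp add: cis_cnj cis_mult)
    finally show ?thesis .
  qed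
  then have "cnj (h (i, k)) * Fent N h i k = of_real (cmod (h (i, k)) / sqrt (real N))" for i
    by (simp add: Fent_def)
  then show ?thesis
    by (simp add: Hent_def sum_divide_distrib)
qed

lemma measurable_PiM_cmod[measurable (raw)]:
  assumes "p \<in> I"
  shows "(\<lambda>h. cmod (h p)) \<in> borel_measurable (CNs I)"
  using assms by measurable

lemma Rcal_chan:
  assumes k: "k < K"
  shows "Rcal P N K k = (\<integral>\<^sup>+h. ennreal (log 2 (1 + P / real K * ((\<Sum>i<N. cmod (h (i, k)))\<^sup>2 / real N))) \<partial>chan N K)"
proof -
  have "(Hmat N K h * Fmat N K h) $$ (k, k) = Hent N h k k" for h
    using k by (simp add: Heq_eq flip: Heq_def)
  then show ?thesis
    by (simp add: Rcal_def Hent_diag norm_divide power_divide sum_nonneg del: of_real_sum of_real_divide)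
qed

text \<open>Only column k enters, and its marginal law is the same for every k; hence the rate does
  not depend on the user.\<close>

lemma Rcal_eq:
  assumes k: "k < K"
  shows "Rcal P N K k = (\<integral>\<^sup>+x. ennreal (log 2 (1 + P / real K * ((\<Sum>i<N. cmod (x i))\<^sup>2 / real N))) \<partial>CNs {..<N})"
proof -
  let ?f = "\<lambda>x. ennreal (log 2 (1 + P / real K * ((\<Sum>i<N. cmod (x i))\<^sup>2 / real N)))"
  have [measurable]: "?f \<in> borel_measurable (CNs {..<N})"
    by measurable
  have "Rcal P N K k = (\<integral>\<^sup>+h. ?f (\<lambda>i\<in>{..<N}. h (i, k)) \<partial>CNs ({..<N} \<times> {..<K}))"
    using k by (simp add: Rcal_chan chan_def)
  also have "\<dots> = (\<integral>\<^sup>+x. ?f x \<partial>CNs {..<N})"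
    using k by (intro nn_integral_CNs_reindex) (auto simp: inj_on_def)
  finally show ?thesis .
qed

lemma measurable_zf_coef:
  assumes ik: "i < N" "k < K"
  shows "(\<lambda>h. zf_coef N K h k i) \<in> borel_measurable (CNs ({..<N} \<times> {..<K}))"
proof -
  have [measurable]: "(\<lambda>h. zf_vec N K h k i) \<in> borel_measurable (CNs ({..<N} \<times> {..<K}))" if "i < N" for i
    unfolding zf_vec_def Heq_eq using that ik(2)
    by (intro borel_measurable_sum borel_measurable_times measurable_Fent measurable_cofactor measurable_Hent) auto
  then have [measurable]: "(\<lambda>h. zf_norm N K h k) \<in> borel_measurable (CNs ({..<N} \<times> {..<K}))"
    unfolding zf_norm_def by measurable
  show ?thesis
    unfolding zf_coef_def using ik(1) by measurable
qed

text \<open>F sees phases only, and the moduli of column k enter \<open>Heq\<close> in row k alone,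
  which the cofactors along that row delete. So the weights survive any shuffling of the moduli of
  user k.\<close>

lemma zf_coef_cong:
  assumes k: "k < K"
    and F: "\<And>i j. i < N \<Longrightarrow> j < K \<Longrightarrow> cis (Arg (h' (i, j))) = cis (Arg (h (i, j)))"
    and H: "\<And>i j. i < N \<Longrightarrow> j < K \<Longrightarrow> j \<noteq> k \<Longrightarrow> h' (i, j) = h (i, j)"
    and i: "i < N"
  shows "zf_coef N K h' k i = zf_coef N K h k i"
proof -
  have F': "Fent N h' i j = Fent N h i j" if "i < N" "j < K" for i j
    using F[OF that] by (simp add: Fent_def)
  have "Hent N h' k' j = Hent N h k' j" if "k' < K" "j < K" "k' \<noteq> k" for k' j
    unfolding Hent_def using that by (intro sum.cong) (auto simp: F' H)
  then have "cofactor (Heq N K h') k j = cofactor (Heq N K h) k j" for j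
    unfolding Heq_eq using k by (intro cofactor_cong) auto
  then have V: "zf_vec N K h' k i = zf_vec N K h k i" if "i < N" for i
    unfolding zf_vec_def using that by (intro sum.cong) (auto simp: F')
  then have "zf_norm N K h' k = zf_norm N K h k"
    unfolding zf_norm_def by simp
  then show ?thesis
    using i by (simp add: zf_coef_def V)
qed

text \<open>All N shifts of the moduli give the same integral, so N times it is the integral of a
  sum over shifts, to which \<open>sum_shifts_ln_le\<close> applies pointwise with common
  weights.\<close>

lemma nn_integral_zf_le:
  assumes N: "N > 0" and k: "k < K" and s: "s \<ge> 0"
  shows "(\<integral>\<^sup>+h. ennreal (log 2 (1 + s * (\<Sum>i<N. cmod (h (i, k)) * zf_coef N K h k i)\<^sup>2)) \<partial>chan N K)
    \<le> (\<integral>\<^sup>+h. ennreal (log 2 (1 + s * ((\<Sum>i<N. cmod (h (i, k)))\<^sup>2 / real N))) \<partial>chan N K)"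
proof -
  define I where "I = {..<N} \<times> {..<K}"
  have chan: "chan N K = CNs I"
    by (simp add: chan_def I_def)
  have fin: "finite I"
    by (simp add: I_def)
  define \<Phi> where "\<Phi> h = ennreal (log 2 (1 + s * (\<Sum>i<N. cmod (h (i, k)) * zf_coef N K h k i)\<^sup>2))" for h
  define \<Psi> where "\<Psi> h = ennreal (log 2 (1 + s * ((\<Sum>i<N. cmod (h (i, k)))\<^sup>2 / real N)))" for h :: "nat \<times> nat \<Rightarrow> complex"
  have hik[measurable]: "(\<lambda>h. cmod (h (i, k))) \<in> borel_measurable (CNs I)" if "i \<in> {..<N}" for i
    using that k by (intro measurable_PiM_cmod) (auto simp: I_def)
  have cik[measurable]: "(\<lambda>h. zf_coef N K h k i) \<in> borel_measurable (CNs I)" if "i \<in> {..<N}" for i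
    using that k measurable_zf_coef[of i N k K] by (simp add: I_def)
  have m\<Phi>[measurable]: "\<Phi> \<in> borel_measurable (CNs I)"
  proof -
    have [measurable]: "(\<lambda>h. \<Sum>i<N. cmod (h (i, k)) * zf_coef N K h k i) \<in> borel_measurable (CNs I)"
      by (intro borel_measurable_sum borel_measurable_times hik cik)
    show ?thesis
      unfolding \<Phi>_def by measurable
  qed
  have m\<Psi>[measurable]: "\<Psi> \<in> borel_measurable (CNs I)"
  proof -
    have [measurable]: "(\<lambda>h. \<Sum>i<N. cmod (h (i, k))) \<in> borel_measurable (CNs I)"
      by (intro borel_measurable_sum hik)
    show ?thesis
      unfolding \<Psi>_def by measurable
  qed
  \<comment> \<open>The antennas are shifted cyclically in column k and the other columns stay
    fixed. Only moduli are moved along this map; \<open>T m\<close> keeps every phase in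
    place.\<close>
  define \<sigma> where "\<sigma> m p = (if snd p = k then ((fst p + m) mod N, k) else p)" for m and p :: "nat \<times> nat"
  have bij: "bij_betw (\<sigma> m) I I" for m
  proof -
    have "inj_on (\<sigma> m) I"
    proof (rule inj_onI)
      fix p q assume pq: "p \<in> I" "q \<in> I" "\<sigma> m p = \<sigma> m q"
      have "snd (\<sigma> m x) = snd x" for x
        by (simp add: \<sigma>_def)
      then have snd: "snd p = snd q"
        using pq(3) by metis
      show "p = q"
      proof (cases "snd p = k")
        case True
        then have "(fst p + m) mod N = (fst q + m) mod N"
          using pq(3) snd by (simp add: \<sigma>_def)
        moreover have "fst p \<in> {..<N}" "fst q \<in> {..<N}"
          using pq(1,2) by (auto simp: I_def)
        ultimately have "fst p = fst q"
          using inj_onD[OF bij_betw_imp_inj_on[OF bij_betw_add_mod[OF N, of m]]] by blast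
        then show ?thesis
          using snd by (simp add: prod_eq_iff)
      next
        case False
        then show ?thesis
          using pq(3) snd by (simp add: \<sigma>_def)
      qed
    qed
    moreover have "\<sigma> m ` I \<subseteq> I"
      using N k by (auto simp: \<sigma>_def I_def)
    ultimately show ?thesis
      using fin by (simp add: bij_betw_def endo_inj_surj)
  qed
  define T where "T m h = (\<lambda>p\<in>I. complex_of_real (cmod (h (\<sigma> m p))) * cis (Arg (h p)))" for m h
  have inv: "(\<integral>\<^sup>+h. \<Phi> (T m h) \<partial>CNs I) = (\<integral>\<^sup>+h. \<Phi> h \<partial>CNs I)" for m
    unfolding T_def by (rule nn_integral_CNs_permute_cmod[OF fin bij m\<Phi>])
  have mT[measurable]: "T m \<in> measurable (CNs I) (CNs I)" for m
    unfolding T_def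
  proof (rule measurable_restrict)
    fix p assume p: "p \<in> I"
    have "(\<lambda>h. complex_of_real (cmod (h q)) * cis (Arg (h p))) \<in> measurable (CNs I) CN01" if "q \<in> I" for q
      using p that by measurable
    moreover have "\<sigma> m p \<in> I"
      using bij p by (auto simp: bij_betw_def)
    ultimately show "(\<lambda>h. complex_of_real (cmod (h (\<sigma> m p))) * cis (Arg (h p))) \<in> measurable (CNs I) CN01"
      by blast
  qed
  have "of_nat N * (\<integral>\<^sup>+h. \<Phi> h \<partial>CNs I) = (\<Sum>m<N. \<integral>\<^sup>+h. \<Phi> (T m h) \<partial>CNs I)"
    by (simp add: inv)
  also have "\<dots> = (\<integral>\<^sup>+h. (\<Sum>m<N. \<Phi> (T m h)) \<partial>CNs I)"
    by (rule nn_integral_sum[symmetric]) measurable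
  also have "\<dots> \<le> (\<integral>\<^sup>+h. of_nat N * \<Psi> h \<partial>CNs I)"
  proof (rule nn_integral_mono_AE)
    show "AE h in CNs I. (\<Sum>m<N. \<Phi> (T m h)) \<le> of_nat N * \<Psi> h"
      using AE_CNs_nonzero[OF fin]
    proof eventually_elim
      case (elim h)
      define r where "r i = cmod (h (i, k))" for i
      define c where "c i = zf_coef N K h k i" for i
      have cT: "zf_coef N K (T m h) k i = c i" if "i < N" for m i
        unfolding c_def
      proof (rule zf_coef_cong[OF k _ _ that])
        fix i j assume ij: "i < N" "j < K"
        then have I': "(i, j) \<in> I" "\<sigma> m (i, j) \<in> I"
          using bij by (auto simp: I_def bij_betw_def)
        show "cis (Arg (T m h (i, j))) = cis (Arg (h (i, j)))"
          using elim I' by (simp add: T_def cis_Arg_cis)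
        assume "j \<noteq> k"
        then show "T m h (i, j) = h (i, j)"
          using I' by (simp add: T_def \<sigma>_def cmod_cis_Arg)
      qed
      have rT: "cmod (T m h (i, k)) = r ((i + m) mod N)" if "i < N" for m i
        using that k by (simp add: T_def \<sigma>_def I_def r_def norm_mult)
      have "(\<Sum>m<N. \<Phi> (T m h)) = (\<Sum>m<N. ennreal (log 2 (1 + s * (\<Sum>i<N. r ((i + m) mod N) * c i)\<^sup>2)))"
        unfolding \<Phi>_def by (simp add: cT rT)
      also have "\<dots> = ennreal ((\<Sum>m<N. ln (1 + s * (\<Sum>i<N. r ((i + m) mod N) * c i)\<^sup>2)) / ln 2)"
        using s by (subst sum_ennreal) (auto simp: log_def sum_divide_distrib)
      also have "\<dots> \<le> ennreal (real N * ln (1 + s * (\<Sum>i<N. r i)\<^sup>2 / real N) / ln 2)"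
        using sum_zf_coef_power2[of N K h k] s N
        by (intro ennreal_leI divide_right_mono sum_shifts_ln_le) (auto simp: r_def c_def)
      also have "\<dots> = of_nat N * \<Psi> h"
        using s by (simp add: \<Psi>_def log_def r_def ennreal_of_nat_eq_real_of_nat flip: ennreal_mult')
      finally show ?case .
    qed
  qed
  also have "\<dots> = of_nat N * (\<integral>\<^sup>+h. \<Psi> h \<partial>CNs I)"
    by (rule nn_integral_cmult) measurable
  finally have "(\<integral>\<^sup>+h. \<Phi> h \<partial>CNs I) \<le> (\<integral>\<^sup>+h. \<Psi> h \<partial>CNs I)"
    using N by (simp add: ennreal_mult_le_mult_iff)
  then show ?thesis
    by (simp add: \<Phi>_def \<Psi>_def chan)
qed

text \<open>Almost sure invertibility of \<open>Heq\<close>, from \<open>K \<le> N\<close>, makes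
  the gain bound available; \<open>Rcal_eq\<close> then exchanges the rate of each user for that of
  k.\<close>

lemma R_PZF_le:
  assumes P: "P > 0" and N: "N \<ge> K" and k: "k < K"
  shows "R_PZF P N K \<le> of_nat K * Rcal P N K k"
proof -
  have "(\<integral>\<^sup>+h. ennreal (log 2 (1 + SINR P N K h l)) \<partial>chan N K) \<le> Rcal P N K k" if l: "l < K" for l
  proof -
    have "(\<integral>\<^sup>+h. ennreal (log 2 (1 + SINR P N K h l)) \<partial>chan N K)
        \<le> (\<integral>\<^sup>+h. ennreal (log 2 (1 + P / real K * (\<Sum>i<N. cmod (h (i, l)) * zf_coef N K h l i)\<^sup>2)) \<partial>chan N K)"
    proof (rule nn_integral_mono_AE)
      show "AE h in chan N K. ennreal (log 2 (1 + SINR P N K h l))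
          \<le> ennreal (log 2 (1 + P / real K * (\<Sum>i<N. cmod (h (i, l)) * zf_coef N K h l i)\<^sup>2))"
        using AE_det_Heq[OF N]
      proof eventually_elim
        case (elim h)
        then show ?case
          using SINR_le[OF elim l P] SINR_nonneg[OF P, of N K h l] by (intro ennreal_leI) simp
      qed
    qed
    also have "\<dots> \<le> (\<integral>\<^sup>+h. ennreal (log 2 (1 + P / real K * ((\<Sum>i<N. cmod (h (i, l)))\<^sup>2 / real N))) \<partial>chan N K)"
      using N k P l by (intro nn_integral_zf_le) auto
    also have "\<dots> = Rcal P N K l"
      by (simp add: Rcal_chan l)
    also have "\<dots> = Rcal P N K k"
      by (simp add: Rcal_eq k l)
    finally show ?thesis .
  qed
  then have "R_PZF P N K \<le> (\<Sum>l<K. Rcal P N K k)"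
    unfolding R_PZF_def by (intro sum_mono) auto
  then show ?thesis
    by simp
qed

section \<open>Asymptotics\<close>

lemma integral_CNs_prod2:
  fixes I :: "'i set"
  assumes I: "finite I" "i \<in> I" "j \<in> I"
  shows "integrable (CNs I) (\<lambda>h. cmod (h i) * cmod (h j))"
    and "(\<integral>h. cmod (h i) * cmod (h j) \<partial>CNs I) = (if i = j then 1 else pi / 4)"
proof -
  \<comment> \<open>Both cases become one product over all coordinates, with factor 1 away from i
    and j; for i = j the two moduli merge into the square.\<close>
  define f where "f l z = (if l = i then cmod z else 1) * (if l = j then cmod z else 1)" for l and z :: complex
  have f: "cmod (h i) * cmod (h j) = (\<Prod>l\<in>I. f l (h l))" for h
    using I by (simp add: f_def prod.distrib)
  have int: "integrable CN01 (f l)" for l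
    using integrable_CN01_cmod integrable_CN01_cmod_power2
    by (cases "l = i"; cases "l = j") (simp_all add: f_def[abs_def] power2_eq_square)
  show "integrable (CNs I) (\<lambda>h. cmod (h i) * cmod (h j))"
    unfolding f using I int by (intro product_sigma_finite.product_integrable_prod[OF product_sigma_finite_CN01])
  have "(\<integral>h. cmod (h i) * cmod (h j) \<partial>CNs I) = (\<Prod>l\<in>I. \<integral>z. f l z \<partial>CN01)"
    unfolding f using I int by (intro product_sigma_finite.product_integral_prod[OF product_sigma_finite_CN01])
  also have "\<dots> = (if i = j then 1 else pi / 4)"
  proof (cases "i = j")
    case True
    then have "(\<integral>z. f l z \<partial>CN01) = 1" for l
      using integral_CN01_cmod_power2 CN01.prob_space
      by (cases "l = i") (simp_all add: f_def power2_eq_square)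
    then show ?thesis
      using True by simp
  next
    case False
    then have "(\<integral>z. f l z \<partial>CN01) = (if l = i then sqrt pi / 2 else 1) * (if l = j then sqrt pi / 2 else 1)" for l
      using integral_CN01_cmod CN01.prob_space
      by (cases "l = i"; cases "l = j") (simp_all add: f_def)
    then show ?thesis
      using False I by (simp add: prod.distrib)
  qed
  finally show "(\<integral>h. cmod (h i) * cmod (h j) \<partial>CNs I) = (if i = j then 1 else pi / 4)" .
qed

lemma integral_CNs_component:
  assumes I: "i \<in> I"
  shows "integrable (CNs I) (\<lambda>h. cmod (h i))"
    and "(\<integral>h. cmod (h i) \<partial>CNs I) = sqrt pi / 2"
proof -
  have d: "distr (CNs I) CN01 (\<lambda>h. h i) = CN01"
    using I by (intro distr_PiM_component prob_space_CN01)
  have [measurable]: "(\<lambda>h. h i) \<in> measurable (CNs I) CN01"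
    using I by measurable
  show "integrable (CNs I) (\<lambda>h. cmod (h i))"
    using integrable_CN01_cmod by (subst (asm) d[symmetric], subst (asm) integrable_distr_eq) auto
  show "(\<integral>h. cmod (h i) \<partial>CNs I) = sqrt pi / 2"
    using integral_CN01_cmod by (subst (asm) d[symmetric], subst (asm) integral_distr) auto
qed

lemma integral_sum_cmod:
  shows "integrable (CNs {..<N}) (\<lambda>x. \<Sum>i<N. cmod (x i))"
    and "(\<integral>x. (\<Sum>i<N. cmod (x i)) \<partial>CNs {..<N}) = real N * (sqrt pi / 2)"
  by (auto intro!: Bochner_Integration.integrable_sum integral_CNs_component
      simp: Bochner_Integration.integral_sum integral_CNs_component)

text \<open>Expanding the square gives N diagonal terms of mean 1 and N(N - 1) mixed terms of mean
  pi/4.\<close>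

lemma integral_sum_cmod_power2:
  shows "integrable (CNs {..<N}) (\<lambda>x. (\<Sum>i<N. cmod (x i))\<^sup>2)"
    and "(\<integral>x. (\<Sum>i<N. cmod (x i))\<^sup>2 \<partial>CNs {..<N}) = real N * (1 + (real N - 1) * (pi / 4))"
proof -
  have sq: "(\<Sum>i<N. cmod (x i))\<^sup>2 = (\<Sum>i<N. \<Sum>j<N. cmod (x i) * cmod (x j))" for x
    by (simp add: power2_eq_square sum_product)
  show "integrable (CNs {..<N}) (\<lambda>x. (\<Sum>i<N. cmod (x i))\<^sup>2)"
    unfolding sq by (intro Bochner_Integration.integrable_sum integral_CNs_prod2) auto
  have "(\<integral>x. (\<Sum>i<N. cmod (x i))\<^sup>2 \<partial>CNs {..<N})
      = (\<Sum>i<N. \<Sum>j<N. \<integral>x. cmod (x i) * cmod (x j) \<partial>CNs {..<N})"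
    unfolding sq
    by (subst Bochner_Integration.integral_sum Bochner_Integration.integrable_sum;
        (intro Bochner_Integration.integrable_sum integral_CNs_prod2 sum.cong Bochner_Integration.integral_sum refl)?) auto
  also have "\<dots> = (\<Sum>i<N. \<Sum>j<N. if i = j then 1 else pi / 4)"
    by (intro sum.cong refl) (simp add: integral_CNs_prod2)
  also have "\<dots> = (\<Sum>i<N. \<Sum>j<N. pi / 4 + (if i = j then 1 - pi / 4 else 0))"
    by (intro sum.cong refl) simp
  also have "\<dots> = (\<Sum>i<N. real N * (pi / 4) + (1 - pi / 4))"
    by (intro sum.cong refl) (simp add: sum.distrib)
  also have "\<dots> = real N * (1 + (real N - 1) * (pi / 4))"
    by (simp add: field_simps)
  finally show "(\<integral>x. (\<Sum>i<N. cmod (x i))\<^sup>2 \<partial>CNs {..<N}) = real N * (1 + (real N - 1) * (pi / 4))" .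
qed

section \<open>Bounds on the rate and the limit\<close>

text \<open>The factor is a lower bound for the indicator of t \<ge> \<mu>/2 that makes Chebyshev's
  inequality a pointwise statement.\<close>
lemma ln_1p_square_ge:
  assumes t: "t \<ge> 0" and \<mu>: "\<mu> > 0" and c: "c \<ge> (0::real)"
  shows "ln (1 + c * t\<^sup>2) \<ge> ln (1 + c * (\<mu> / 2)\<^sup>2) * (1 - 4 * (t - \<mu>)\<^sup>2 / \<mu>\<^sup>2)"
proof (cases "t \<ge> \<mu> / 2")
  case True
  have pos: "ln (1 + c * (\<mu> / 2)\<^sup>2) \<ge> 0"
    using c by simp
  then have "ln (1 + c * (\<mu> / 2)\<^sup>2) * (1 - 4 * (t - \<mu>)\<^sup>2 / \<mu>\<^sup>2) \<le> ln (1 + c * (\<mu> / 2)\<^sup>2) * 1"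
    by (intro mult_left_mono) auto
  also have "\<dots> \<le> ln (1 + c * t\<^sup>2)"
  proof -
    have "c * (\<mu> / 2)\<^sup>2 \<le> c * t\<^sup>2"
      using True \<mu> c by (intro mult_left_mono power_mono) auto
    moreover have "0 < 1 + c * (\<mu> / 2)\<^sup>2"
      using c by (intro add_pos_nonneg) auto
    ultimately show ?thesis
      by simp
  qed
  finally show ?thesis .
next
  case False
  then have "(\<mu> / 2)\<^sup>2 \<le> (\<mu> - t)\<^sup>2"
    using t \<mu> by (intro power_mono) auto
  then have "1 - 4 * (t - \<mu>)\<^sup>2 / \<mu>\<^sup>2 \<le> 0"
    using \<mu> by (simp add: field_simps power2_commute[of t])
  then have "ln (1 + c * (\<mu> / 2)\<^sup>2) * (1 - 4 * (t - \<mu>)\<^sup>2 / \<mu>\<^sup>2) \<le> 0"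
    using c by (intro mult_nonneg_nonpos) auto
  also have "0 \<le> ln (1 + c * t\<^sup>2)"
    using c by simp
  finally show ?thesis .
qed

text \<open>Let X be the sum of the moduli. The upper bound is Jensen's inequality with E X^2 / N =
  1 + (N - 1) pi/4. The lower bound uses the mean \<mu> = sqrt pi / 2 and the variance (1 - pi/4) /
  N of X / N: inside the logarithm stands (\<mu>/2)^2 = pi/16, and 4 times the variance over \<mu>^2
  is (16/pi - 4) / N.\<close>

lemma enn2real_Rcal_bounds:
  assumes P: "P > 0" and k: "k < K" and N: "N > 0"
  defines "s \<equiv> P / real K"
  shows "enn2real (Rcal P N K k) * ln 2 \<le> ln (1 + s * (1 + (real N - 1) * (pi / 4)))"
    and "enn2real (Rcal P N K k) * ln 2 \<ge> ln (1 + s * real N * (pi / 16)) * (1 - (16 / pi - 4) / real N)"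
proof -
  let ?M = "CNs {..<N}"
  interpret M: prob_space ?M
    by (rule prob_space_CNs)
  define X where "X x = (\<Sum>i<N. cmod (x i))" for x :: "nat \<Rightarrow> complex"
  define \<mu> where "\<mu> = sqrt pi / 2"
  have s: "s > 0"
    using P k by (simp add: s_def)
  have X0: "X x \<ge> 0" for x
    by (simp add: X_def sum_nonneg)
  have \<mu>: "\<mu> > 0" "\<mu>\<^sup>2 = pi / 4"
    by (simp_all add: \<mu>_def power_divide)
  have iX: "integrable ?M X" and EX: "(\<integral>x. X x \<partial>?M) = real N * \<mu>"
    using integral_sum_cmod[of N] by (simp_all add: X_def[abs_def] \<mu>_def)
  have iX2: "integrable ?M (\<lambda>x. (X x)\<^sup>2)"
    and EX2: "(\<integral>x. (X x)\<^sup>2 \<partial>?M) = real N * (1 + (real N - 1) * (pi / 4))"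
    using integral_sum_cmod_power2[of N] by (simp_all add: X_def[abs_def])
  note [measurable] = borel_measurable_integrable[OF iX]
  define L where "L x = ln (1 + s * ((X x)\<^sup>2 / real N))" for x
  have L0: "L x \<ge> 0" for x
    using s by (simp add: L_def)
  have [measurable]: "L \<in> borel_measurable ?M"
    unfolding L_def by measurable
  \<comment> \<open>The tangent is taken at the mean of \<open>s * ((X x)\<^sup>2 / real N)\<close>,
    so the linear part of U integrates to 0.\<close>
  define y where "y = s * (1 + (real N - 1) * (pi / 4))"
  have y: "y \<ge> 0"
    using s N by (simp add: y_def)
  define U where "U x = ln (1 + y) + (s * ((X x)\<^sup>2 / real N) - y) / (1 + y)" for x
  have iU: "integrable ?M U"
    unfolding U_def using iX2 by simp
  have LU: "L x \<le> U x" for x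
    unfolding L_def U_def using s y by (intro ln_1p_le_tangent) auto
  \<comment> \<open>Domination by U also makes the rate finite, so \<open>enn2real\<close> does not
    return its default value 0 for infinity.\<close>
  have iL: "integrable ?M L"
    by (rule Bochner_Integration.integrable_bound[OF iU]) (auto intro!: AE_I2 simp: L0 order_trans[OF LU abs_ge_self])
  have "Rcal P N K k = (\<integral>\<^sup>+x. ennreal (L x / ln 2) \<partial>?M)"
    by (simp add: Rcal_eq[OF k] L_def X_def s_def log_def)
  also have "\<dots> = ennreal ((\<integral>x. L x \<partial>?M) / ln 2)"
    using iL L0 by (subst nn_integral_eq_integral) auto
  finally have R: "enn2real (Rcal P N K k) * ln 2 = (\<integral>x. L x \<partial>?M)"
    using L0 by (simp add: integral_nonneg_AE)
  have "(\<integral>x. L x \<partial>?M) \<le> (\<integral>x. U x \<partial>?M)"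
    using iL iU LU by (intro integral_mono)
  also have "\<dots> = ln (1 + y)"
    unfolding U_def using iX2 N M.prob_space by (simp add: EX2 y_def)
  finally show "enn2real (Rcal P N K k) * ln 2 \<le> ln (1 + s * (1 + (real N - 1) * (pi / 4)))"
    by (simp add: R y_def)
  define B where "B = ln (1 + s * real N * (\<mu> / 2)\<^sup>2)"
  define V where "V x = B * (1 - 4 * (X x / real N - \<mu>)\<^sup>2 / \<mu>\<^sup>2)" for x
  have V_eq: "V x = B * (1 - 4 * ((X x)\<^sup>2 / (real N)\<^sup>2 - 2 * \<mu> / real N * X x + \<mu>\<^sup>2) / \<mu>\<^sup>2)" for x
    by (simp add: V_def power2_diff power_divide mult.commute)
  have iV: "integrable ?M V"
    unfolding V_eq using iX iX2 by simp
  have VL: "V x \<le> L x" for x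
  proof -
    \<comment> \<open>\<open>ln_1p_square_ge\<close> is applied to the average X / N, which moves a
      factor N into the constant.\<close>
    have "L x = ln (1 + s * real N * (X x / real N)\<^sup>2)"
      using N by (simp add: L_def power_divide power2_eq_square)
    then show ?thesis
      unfolding V_def B_def using ln_1p_square_ge[of "X x / real N" \<mu> "s * real N"] s \<mu>(1) X0 by simp
  qed
  have "(\<integral>x. V x \<partial>?M) = B * (1 - 4 * (real N * (1 + (real N - 1) * (pi / 4)) / (real N)\<^sup>2
      - 2 * \<mu> / real N * (real N * \<mu>) + \<mu>\<^sup>2) / \<mu>\<^sup>2)"
    unfolding V_eq using iX iX2 M.prob_space by (simp add: EX EX2)
  also have "2 * \<mu> / real N * (real N * \<mu>) = 2 * \<mu>\<^sup>2"
    using N by (simp add: power2_eq_square)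
  also have "1 - 4 * (real N * (1 + (real N - 1) * (pi / 4)) / (real N)\<^sup>2 - 2 * \<mu>\<^sup>2 + \<mu>\<^sup>2) / \<mu>\<^sup>2
      = 1 - (16 / pi - 4) / real N"
    unfolding \<mu>(2) using N by (simp add: field_simps power2_eq_square)
  also have "B = ln (1 + s * real N * (pi / 16))"
    by (simp add: B_def power_divide \<mu>)
  finally have "(\<integral>x. V x \<partial>?M) = ln (1 + s * real N * (pi / 16)) * (1 - (16 / pi - 4) / real N)" .
  moreover have "(\<integral>x. V x \<partial>?M) \<le> (\<integral>x. L x \<partial>?M)"
    using iL iV VL by (intro integral_mono)
  ultimately show "enn2real (Rcal P N K k) * ln 2 \<ge> ln (1 + s * real N * (pi / 16)) * (1 - (16 / pi - 4) / real N)"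
    by (simp add: R)
qed

text \<open>Both bounds divided by the target tend to 1: constant factors inside the logarithm
  change it by a bounded amount while it diverges, and the Chebyshev factor tends to 1.\<close>

lemma Rcal_asymp:
  assumes P: "P > 0" and k: "k < K"
  shows "(\<lambda>N. enn2real (Rcal P N K k) / log 2 (1 + pi / 4 * P * real N / real K)) \<longlonglongrightarrow> 1"
proof (rule real_tendsto_sandwich)
  define s where "s = P / real K"
  have s: "s > 0"
    using P k by (simp add: s_def)
  define d where "d N = ln (1 + s * (pi / 4) * real N)" for N
  have d: "log 2 (1 + pi / 4 * P * real N / real K) = d N / ln 2" for N
    by (simp add: d_def log_def s_def mult_ac)
  \<comment> \<open>At N = 0 the denominator vanishes, so the estimates are made for positive N
    only.\<close>
  have d0: "d N > 0" if "N > 0" for N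
    unfolding d_def using s that by (intro ln_gt_zero) simp
  show "\<forall>\<^sub>F N in sequentially. ln (1 + s * real N * (pi / 16)) * (1 - (16 / pi - 4) / real N) / d N
      \<le> enn2real (Rcal P N K k) / log 2 (1 + pi / 4 * P * real N / real K)"
    using eventually_gt_at_top[of 0]
  proof eventually_elim
    case (elim N)
    have "ln (1 + s * real N * (pi / 16)) * (1 - (16 / pi - 4) / real N) / d N \<le> enn2real (Rcal P N K k) * ln 2 / d N"
      using enn2real_Rcal_bounds(2)[OF P k elim, folded s_def] d0[OF elim] by (intro divide_right_mono) auto
    then show ?case
      unfolding d by simp
  qed
  show "\<forall>\<^sub>F N in sequentially. enn2real (Rcal P N K k) / log 2 (1 + pi / 4 * P * real N / real K)
      \<le> ln (1 + s * (1 + (real N - 1) * (pi / 4))) / d N"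
    using eventually_gt_at_top[of 0]
  proof eventually_elim
    case (elim N)
    have "ln (1 + s * (1 + (real N - 1) * (pi / 4))) / d N \<ge> enn2real (Rcal P N K k) * ln 2 / d N"
      using enn2real_Rcal_bounds(1)[OF P k elim, folded s_def] d0[OF elim] by (intro divide_right_mono) auto
    then show ?case
      unfolding d by simp
  qed
  show "(\<lambda>N. ln (1 + s * real N * (pi / 16)) * (1 - (16 / pi - 4) / real N) / d N) \<longlonglongrightarrow> 1"
    unfolding d_def using s by real_asymp
  show "(\<lambda>N. ln (1 + s * (1 + (real N - 1) * (pi / 4))) / d N) \<longlonglongrightarrow> 1"
    unfolding d_def using s by real_asymp
qed

theorem theorem1:
  fixes K :: nat and P :: real
  assumes "K \<ge> 1" and "P > 0"
  shows "(\<forall>Nt \<ge> K. \<forall>k < K. R_PZF P Nt K \<le> of_nat K * Rcal P Nt K k)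
       \<and> (\<forall>k < K. (\<lambda>Nt. enn2real (Rcal P Nt K k) / log 2 (1 + pi / 4 * P * real Nt / real K))
              \<longlonglongrightarrow> 1)"
  using assms by (intro conjI allI impI R_PZF_le Rcal_asymp)

end
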